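(* Let $M$ be a connected complex manifold and let $H(M)$ be the ring of holomorphic functions $M\to\mathbb{C}$. Then the Krull dimension of $H(M)$ either equals $0$, which happens if and only if $H(M)=\mathbb{C}$ (i.e. every holomorphic function on $M$ is constant), or is infinite, which happens if and only if $M$ admits a nonconstant holomorphic function $M\to\mathbb{C}$. More precisely, unless $H(M)=\mathbb{C}$, one has $\dim H(M)\ge \mathfrak{c}$, i.e. the ring $H(M)$ contains a chain of distinct prime ideals whose length has the cardinality of the continuum.
   Context: For a commutative ring $R$, the Krull dimension $\dim(R)$ is the supremum of the cardinalities of lengths of chains (families totally ordered by inclusion) of distinct proper prime ideals in $R$. Here a finite chain $\mathfrak p_0\subsetneq\dots\subsetneq\mathfrak p_n$ has length $n$, and the length of an infinite chain is its cardinality. $\mathfrak{c}$ denotes the cardinality of the continuum. Constant functions are identified with elements of $\mathbb{C}$, so that $\mathbb{C}\subset H(M)$. *)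

theory Defs
  imports "HOL-Analysis.Analysis" "HOL-Algebra.Ideal"
begin

no_notation elt_set_eq (infix \<open>=o\<close> 50)

unbundle cardinal_syntax

section \<open>Holomorphic functions of several variables\<close>

text \<open>
  As for \<open>Euclidean_space\<close>, the space \<open>\<complex>\<^sup>n\<close> consists of the sequences vanishing from index
  \<open>n\<close> on; its topology is the one induced by the product topology on \<^typ>\<open>nat \<Rightarrow> complex\<close>.
  The dimension \<open>n = 0\<close> is allowed.
\<close>

definition complex_space :: "nat \<Rightarrow> (nat \<Rightarrow> complex) set" where
  "complex_space n = {z. \<forall>i\<ge>n. z i = 0}"

text \<open>Complex (Frechet) differentiability at every point; used for \<open>U\<close> open in \<open>\<complex>\<^sup>n\<close>.\<close>

definition cn_holomorphic_on ::
    "nat \<Rightarrow> ((nat \<Rightarrow> complex) \<Rightarrow> complex) \<Rightarrow> (nat \<Rightarrow> complex) set \<Rightarrow> bool" where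
  "cn_holomorphic_on n f U \<longleftrightarrow>
     (\<forall>z\<in>U. \<exists>a :: nat \<Rightarrow> complex.
        ((\<lambda>w. (f w - f z - (\<Sum>i<n. a i * (w i - z i))) /
              of_real (L2_set (\<lambda>i. cmod (w i - z i)) {..<n})) \<longlongrightarrow> 0) (at z within U))"


section \<open>Complex manifolds\<close>

text \<open>
  The manifold is \<open>X\<close> with a holomorphic atlas \<open>A\<close>, which need not be maximal. Second countability is
  not required.
\<close>

locale complex_manifold =
  fixes n :: nat
    and X :: "'a topology"
    and A :: "('a set \<times> ('a \<Rightarrow> nat \<Rightarrow> complex)) set"
  assumes Hausdorff: "Hausdorff_space X"
    and chart_domain: "(U, \<phi>) \<in> A \<Longrightarrow> openin X U"
    and chart_codomain: "(U, \<phi>) \<in> A \<Longrightarrow> openin (top_of_set (complex_space n)) (\<phi> ` U)"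
    and chart_homeomorphic:
      "(U, \<phi>) \<in> A \<Longrightarrow> homeomorphic_map (subtopology X U) (top_of_set (\<phi> ` U)) \<phi>"
    and charts_cover: "(\<Union>(U, \<phi>)\<in>A. U) = topspace X"
    and charts_compatible:
      "\<lbrakk>(U, \<phi>) \<in> A; (V, \<psi>) \<in> A; i < n\<rbrakk> \<Longrightarrow>
         cn_holomorphic_on n (\<lambda>z. \<psi> (inv_into U \<phi> z) i) (\<phi> ` (U \<inter> V))"

definition holomorphic_function ::
    "nat \<Rightarrow> 'a topology \<Rightarrow> ('a set \<times> ('a \<Rightarrow> nat \<Rightarrow> complex)) set \<Rightarrow> ('a \<Rightarrow> complex) \<Rightarrow> bool" where
  "holomorphic_function n X A f \<longleftrightarrow>
     (\<forall>(U, \<phi>)\<in>A. cn_holomorphic_on n (\<lambda>z. f (inv_into U \<phi> z)) (\<phi> ` U))"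

text \<open>
  Functions on the manifold are represented by functions on the ambient type that are
  \<open>undefined\<close> outside \<open>topspace X\<close>, so that equality is equality on the manifold.
\<close>

definition holomorphic_ring ::
    "nat \<Rightarrow> 'a topology \<Rightarrow> ('a set \<times> ('a \<Rightarrow> nat \<Rightarrow> complex)) set \<Rightarrow> ('a \<Rightarrow> complex) ring" where
  "holomorphic_ring n X A =
     \<lparr>carrier = {f \<in> extensional (topspace X). holomorphic_function n X A f},
      monoid.mult = (\<lambda>f g. \<lambda>x\<in>topspace X. f x * g x),
      one = (\<lambda>x\<in>topspace X. 1),
      zero = (\<lambda>x\<in>topspace X. 0),
      add = (\<lambda>f g. \<lambda>x\<in>topspace X. f x + g x)\<rparr>"

definition constant_functions :: "'a topology \<Rightarrow> ('a \<Rightarrow> complex) set" where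
  "constant_functions X = range (\<lambda>c. \<lambda>x\<in>topspace X. c)"


section \<open>Krull dimension as a cardinal\<close>

definition prime_chain :: "('a, 'b) ring_scheme \<Rightarrow> 'a set set \<Rightarrow> bool" where
  "prime_chain R C \<longleftrightarrow> C \<noteq> {} \<and> C \<in> chains {P. primeideal P R}"

text \<open>
  The smallest member of a finite nonempty chain \<open>C\<close> is \<open>\<Inter>C\<close>; omitting it turns the number of
  members into the length.
\<close>

definition chain_length :: "'a set set \<Rightarrow> 'a set rel" where
  "chain_length C = (if finite C then |C - {\<Inter>C}| else |C| )"

lemma card_of_chain_length_finite:
  assumes "prime_chain R C" "finite C"
  shows "chain_length C = |C - {\<Inter>C}|" "card (C - {\<Inter>C}) = card C - 1"
proof -
  have C: "subset.chain UNIV C" "C \<noteq> {}"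
    using assms by (auto simp: prime_chain_def chains_def chain_subset_def subset_chain_def)
  then have "\<Inter>C \<in> C"
    using assms(2) by (intro Inter_in_chain) auto
  then show "card (C - {\<Inter>C}) = card C - 1"
    by simp
qed (use assms in \<open>simp add: chain_length_def\<close>)

text \<open>
  Cardinals are cardinal orders up to \<open>=o\<close>. A cardinal that does not embed into \<^typ>\<open>'a set set\<close>
  is larger than the length of every chain, so it is enough to compare with upper bounds on
  the type \<^typ>\<open>'a set\<close>.
\<close>

definition is_krull_dim :: "('a, 'b) ring_scheme \<Rightarrow> 'a set rel \<Rightarrow> bool" where
  "is_krull_dim R \<kappa> \<longleftrightarrow>
     Card_order \<kappa> \<and>
     (\<forall>C. prime_chain R C \<longrightarrow> chain_length C \<le>o \<kappa>) \<and>
     (\<forall>\<mu> :: 'a set rel.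
        Card_order \<mu> \<and> (\<forall>C. prime_chain R C \<longrightarrow> chain_length C \<le>o \<mu>) \<longrightarrow> \<kappa> \<le>o \<mu>)"

definition krull_dim :: "('a, 'b) ring_scheme \<Rightarrow> 'a set rel" where
  "krull_dim R = (SOME \<kappa>. is_krull_dim R \<kappa>)"

lemma is_krull_dim_krull_dim: "is_krull_dim R (krull_dim R)"
proof -
  define B where
    "B = {\<kappa> :: 'a set rel. Card_order \<kappa> \<and> (\<forall>C. prime_chain R C \<longrightarrow> chain_length C \<le>o \<kappa>)}"
  have "chain_length C \<le>o |UNIV :: 'a set set|" for C :: "'a set set"
    unfolding chain_length_def by (simp add: card_of_mono1)
  then have "|UNIV :: 'a set set| \<in> B"
    unfolding B_def by (simp add: card_of_Card_order)
  then have "B \<noteq> {}"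
    by blast
  moreover have "\<forall>\<kappa>\<in>B. Card_order \<kappa>"
    by (simp add: B_def)
  ultimately have "\<exists>\<kappa>\<in>B. \<forall>\<kappa>'\<in>B. \<kappa> \<le>o \<kappa>'"
    by (rule exists_minim_Card_order)
  then obtain \<kappa> where "\<kappa> \<in> B" "\<forall>\<kappa>'\<in>B. \<kappa> \<le>o \<kappa>'"
    by blast
  then have "is_krull_dim R \<kappa>"
    unfolding is_krull_dim_def B_def by simp
  then show ?thesis
    unfolding krull_dim_def by (rule someI)
qed

lemma krull_dim_unique:
  assumes "is_krull_dim R \<kappa>"
  shows "\<kappa> =o krull_dim R"
proof -
  have "\<kappa> \<le>o krull_dim R" "krull_dim R \<le>o \<kappa>"
    using assms is_krull_dim_krull_dim[of R] unfolding is_krull_dim_def by simp_all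
  then show ?thesis
    by (simp add: ordIso_iff_ordLeq)
qed

end

theory Submission
  imports
    Defs
    "HOL-Complex_Analysis.Complex_Analysis"
    "HOL-Real_Asymp.Real_Asymp"
begin

text \<open>
  If \<open>H(M)\<close> contains a nonconstant function, it contains an unbounded one: the image \<open>f(M)\<close> is open,
  so either it is \<open>\<complex>\<close> or \<open>1 / (f - p)\<close> is unbounded for a boundary point \<open>p\<close>. Choose points \<open>x\<^sub>i\<close> with
  \<open>f(x\<^sub>i) \<rightarrow> \<infinity>\<close> and a holomorphic disc through each \<open>x\<^sub>i\<close> on which \<open>f\<close> is not constant. For a
  nonprincipal ultrafilter on \<open>\<nat>\<close>, the functions \<open>g\<close> whose vanishing order along the \<open>i\<close>-th disc,
  relative to that of \<open>f - f(x\<^sub>i)\<close>, exceeds every multiple of \<open>d\<^sub>t(i)\<close> for almost all \<open>i\<close> form a prime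
  ideal \<open>P\<^sub>t\<close>. If \<open>d\<^sub>t\<close> for \<open>t \<in> \<real>\<close> are orders of growth each dominating all multiples of the earlier
  ones, the \<open>P\<^sub>t\<close> form a strictly decreasing chain: they are separated by \<open>W \<circ> f\<close>, where \<open>W\<close> is an
  entire Weierstrass product vanishing to order exactly \<open>d\<^sub>t(i)\<close> at \<open>f(x\<^sub>i)\<close>.
\<close>

section \<open>Holomorphic functions on \<open>\<complex>\<^sup>n\<close>\<close>

text \<open>
  The Caratheodory form of differentiability: it turns the product rule, the chain rule and the
  restriction to complex lines into algebraic identities.
\<close>

definition cn_slope :: "nat \<Rightarrow> ((nat \<Rightarrow> complex) \<Rightarrow> complex) \<Rightarrow> (nat \<Rightarrow> complex) \<Rightarrow> (nat \<Rightarrow> complex) set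
    \<Rightarrow> (nat \<Rightarrow> (nat \<Rightarrow> complex) \<Rightarrow> complex) \<Rightarrow> bool" where
  "cn_slope n f z U q \<longleftrightarrow>
     (\<forall>i<n. continuous (at z within U) (q i)) \<and>
     (\<forall>w\<in>U. f w = f z + (\<Sum>i<n. q i w * (w i - z i)))"

lemma continuous_within_coordinate:
  "continuous (at z within U) (\<lambda>w :: nat \<Rightarrow> complex. w i)"
  by (rule continuous_on_imp_continuous_within[of UNIV]) auto

lemma L2_set_complex_space_eq_0_iff:
  assumes "z \<in> complex_space n" "w \<in> complex_space n"
  shows "L2_set (\<lambda>i. cmod (w i - z i)) {..<n} = 0 \<longleftrightarrow> w = z"
proof -
  have "w = z" if "\<forall>i<n. w i = z i"
  proof
    show "w i = z i" for i
      using assms that by (cases "i < n") (auto simp: complex_space_def)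
  qed
  then show ?thesis
    by (auto simp: L2_set_eq_0_iff)
qed

text \<open>Slopes give the derivative \<open>a i = q i z\<close>. Conversely, the remainder of a
  derivative can be absorbed into the slopes, because away from \<open>z\<close> the first
  \<open>n\<close> coordinate differences are not all zero.\<close>

lemma cn_holomorphic_on_iff_slope:
  assumes "U \<subseteq> complex_space n"
  shows "cn_holomorphic_on n f U \<longleftrightarrow> (\<forall>z\<in>U. \<exists>q. cn_slope n f z U q)"
proof -
  let ?L = "\<lambda>z w. L2_set (\<lambda>i. cmod (w i - z i)) {..<n}"
  have "(\<exists>q. cn_slope n f z U q) \<longleftrightarrow>
     (\<exists>a. ((\<lambda>w. (f w - f z - (\<Sum>i<n. a i * (w i - z i))) / of_real (?L z w)) \<longlongrightarrow> 0) (at z within U))"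
    (is "?A \<longleftrightarrow> ?B") if z: "z \<in> U" for z
  proof
    assume ?A
    then obtain q where q: "\<And>i. i < n \<Longrightarrow> continuous (at z within U) (q i)"
        and f: "\<And>w. w \<in> U \<Longrightarrow> f w = f z + (\<Sum>i<n. q i w * (w i - z i))"
      by (auto simp: cn_slope_def)
    have "((\<lambda>w. (f w - f z - (\<Sum>i<n. q i z * (w i - z i))) / of_real (?L z w)) \<longlongrightarrow> 0) (at z within U)"
    proof (rule Lim_null_comparison)
      have "norm ((f w - f z - (\<Sum>i<n. q i z * (w i - z i))) / of_real (?L z w)) \<le>
          (\<Sum>i<n. norm (q i w - q i z))" if w: "w \<in> U" for w
      proof -
        have "norm (f w - f z - (\<Sum>i<n. q i z * (w i - z i))) =
            norm (\<Sum>i<n. (q i w - q i z) * (w i - z i))"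
          unfolding f[OF w] by (simp add: sum_subtractf left_diff_distrib)
        also have "\<dots> \<le> (\<Sum>i<n. norm (q i w - q i z) * norm (w i - z i))"
          by (rule order_trans[OF norm_sum]) (simp add: norm_mult)
        also have "\<dots> \<le> (\<Sum>i<n. norm (q i w - q i z) * ?L z w)"
          by (intro sum_mono mult_left_mono member_le_L2_set) auto
        finally have "norm (f w - f z - (\<Sum>i<n. q i z * (w i - z i))) \<le> (\<Sum>i<n. norm (q i w - q i z)) * ?L z w"
          by (simp add: sum_distrib_right)
        then show ?thesis
          using L2_set_nonneg[of "\<lambda>i. cmod (w i - z i)" "{..<n}"]
          by (cases "?L z w = 0") (auto simp: norm_divide pos_divide_le_eq order_less_le sum_nonneg)
      qed
      then show "\<forall>\<^sub>F w in at z within U. norm ((f w - f z - (\<Sum>i<n. q i z * (w i - z i))) / of_real (?L z w)) \<le>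
          (\<Sum>i<n. norm (q i w - q i z))"
        by (auto simp: eventually_at_filter)
      have "((\<lambda>w. \<Sum>i<n. norm (q i w - q i z)) \<longlongrightarrow> (\<Sum>i<n. norm (q i z - q i z))) (at z within U)"
        by (intro tendsto_intros) (use q in \<open>auto simp: continuous_within\<close>)
      then show "((\<lambda>w. \<Sum>i<n. norm (q i w - q i z)) \<longlongrightarrow> 0) (at z within U)"
        by simp
    qed
    then show ?B
      by (rule exI[of _ "\<lambda>i. q i z"])
  next
    assume ?B
    then obtain a where a:
      "((\<lambda>w. (f w - f z - (\<Sum>i<n. a i * (w i - z i))) / of_real (?L z w)) \<longlongrightarrow> 0) (at z within U)" ..
    define r where "r w = f w - f z - (\<Sum>i<n. a i * (w i - z i))" for w
    \<comment> \<open>The remainder is spread over the coordinates with weights proportional to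
      \<open>cnj (w i - z i)\<close>; multiplied by \<open>w i - z i\<close> and summed, these give
      the squared norm over itself. At \<open>w = z\<close> the added term is 0, so
      \<open>q i z = a i\<close>.\<close>
    define q where "q i w = a i + r w / of_real (?L z w) * (cnj (w i - z i) / of_real (?L z w))" for i w
    have "cn_slope n f z U q"
      unfolding cn_slope_def
    proof (intro conjI allI impI ballI)
      fix i assume i: "i < n"
      have "((\<lambda>w. r w / of_real (?L z w) * (cnj (w i - z i) / of_real (?L z w))) \<longlongrightarrow> 0) (at z within U)"
      proof (rule Lim_null_comparison)
        have "norm (cnj (w i - z i) / of_real (?L z w)) \<le> 1" for w
          using i member_le_L2_set[of "{..<n}" i "\<lambda>i. cmod (w i - z i)"]
          by (simp only: norm_divide complex_mod_cnj norm_of_real abs_of_nonneg[OF L2_set_nonneg] divide_le_eq_1) (auto simp: order_less_le)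
        then have "norm (r w / of_real (?L z w) * (cnj (w i - z i) / of_real (?L z w))) \<le>
            norm (r w / of_real (?L z w))" for w
          unfolding norm_mult by (intro mult_left_le) auto
        then show "\<forall>\<^sub>F w in at z within U.
            norm (r w / of_real (?L z w) * (cnj (w i - z i) / of_real (?L z w))) \<le> norm (r w / of_real (?L z w))"
          by (intro always_eventually allI)
        show "((\<lambda>w. norm (r w / of_real (?L z w))) \<longlongrightarrow> 0) (at z within U)"
          using tendsto_norm_zero[OF a] by (simp only: r_def)
      qed
      then have "((\<lambda>w. q i w) \<longlongrightarrow> a i + 0) (at z within U)"
        unfolding q_def by (intro tendsto_intros)
      moreover have "q i z = a i"
        by (simp add: q_def r_def)
      ultimately show "continuous (at z within U) (q i)"
        by (simp add: continuous_within)
    next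
      fix w assume w: "w \<in> U"
      show "f w = f z + (\<Sum>i<n. q i w * (w i - z i))"
      proof (cases "w = z")
        case False
        then have L: "?L z w \<noteq> 0"
          using L2_set_complex_space_eq_0_iff w z assms by blast
        have "(\<Sum>i<n. r w / of_real (?L z w) * (cnj (w i - z i) / of_real (?L z w)) * (w i - z i)) =
            r w / of_real ((?L z w)\<^sup>2) * of_real (\<Sum>i<n. (norm (w i - z i))\<^sup>2)"
          unfolding sum_distrib_left of_real_sum complex_norm_square
        proof (intro sum.cong refl)
          have "a / of_real L * (c / of_real L) * d = a / of_real (L\<^sup>2) * (d * c)" for a c d :: complex and L :: real
            by (simp add: power2_eq_square)
          then show "r w / of_real (?L z w) * (cnj (w i - z i) / of_real (?L z w)) * (w i - z i) =
              r w / of_real ((?L z w)\<^sup>2) * ((w i - z i) * cnj (w i - z i))" for i .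
        qed
        also have "(\<Sum>i<n. (norm (w i - z i))\<^sup>2) = (?L z w)\<^sup>2"
          by (simp add: L2_set_def sum_nonneg)
        finally have "(\<Sum>i<n. r w / of_real (?L z w) * (cnj (w i - z i) / of_real (?L z w)) * (w i - z i)) = r w"
          using L by (simp only: of_real_eq_0_iff power_eq_0_iff nonzero_eq_divide_eq times_divide_eq_left) simp
        then have "(\<Sum>i<n. q i w * (w i - z i)) = (\<Sum>i<n. a i * (w i - z i)) + r w"
          unfolding q_def by (simp only: distrib_right sum.distrib)
        then show ?thesis
          by (simp add: r_def)
      qed simp
    qed
    then show ?A
      by blast
  qed
  then show ?thesis
    unfolding cn_holomorphic_on_def by blast
qed

section \<open>Calculus of slopes\<close>

lemma cn_slope_continuous:
  assumes "cn_slope n f z U q" "z \<in> U"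
  shows "continuous (at z within U) f"
proof -
  have "continuous (at z within U) (\<lambda>w. f z + (\<Sum>i<n. q i w * (w i - z i)))"
    using assms(1) unfolding cn_slope_def
    by (intro continuous_intros continuous_within_coordinate) auto
  then show ?thesis
    by (rule continuous_transform_within[OF _ zero_less_one assms(2)])
       (use assms(1) in \<open>simp add: cn_slope_def\<close>)
qed

lemma cn_slope_add:
  assumes "cn_slope n f z U p" "cn_slope n g z U q"
  shows "cn_slope n (\<lambda>w. f w + g w) z U (\<lambda>i w. p i w + q i w)"
  using assms unfolding cn_slope_def sum.distrib distrib_right
  by (simp add: continuous_add algebra_simps)

text \<open>From \<open>f w * g w - f z * g z = f w * (g w - g z) + g z * (f w - f z)\<close>. The
  factor \<open>f w\<close> varies, so continuity of the new slopes uses that of \<open>f\<close> at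
  \<open>z\<close>.\<close>

lemma cn_slope_mult:
  assumes "cn_slope n f z U p" "cn_slope n g z U q" "z \<in> U"
  shows "cn_slope n (\<lambda>w. f w * g w) z U (\<lambda>i w. f w * q i w + g z * p i w)"
proof -
  have "f w * g w = f z * g z + (\<Sum>i<n. (f w * q i w + g z * p i w) * (w i - z i))" if "w \<in> U" for w
  proof -
    have "(\<Sum>i<n. (f w * q i w + g z * p i w) * (w i - z i)) =
        f w * (\<Sum>i<n. q i w * (w i - z i)) + g z * (\<Sum>i<n. p i w * (w i - z i))"
      by (simp add: sum.distrib distrib_right sum_distrib_left mult.assoc)
    also have "(\<Sum>i<n. q i w * (w i - z i)) = g w - g z"
      using assms(2) that by (simp add: cn_slope_def)
    also have "(\<Sum>i<n. p i w * (w i - z i)) = f w - f z"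
      using assms(1) that by (simp add: cn_slope_def)
    finally show ?thesis
      by (simp add: algebra_simps)
  qed
  moreover have "continuous (at z within U) f"
    using assms by (simp add: cn_slope_continuous)
  moreover have "continuous (at z within U) (p i)" "continuous (at z within U) (q i)" if "i < n" for i
    using assms that by (simp_all add: cn_slope_def)
  ultimately show ?thesis
    unfolding cn_slope_def by (intro conjI allI impI ballI continuous_intros)
qed

text \<open>The one-variable slope \<open>k\<close> of \<open>h\<close>, evaluated along
  \<open>f\<close>, multiplies the slopes of \<open>f\<close>.\<close>

lemma cn_slope_compose:
  assumes "cn_slope n f z U q" "z \<in> U" and h: "(h has_field_derivative d) (at (f z))"
  shows "\<exists>r. cn_slope n (\<lambda>w. h (f w)) z U r"
proof -
  obtain k where k: "\<And>y. h y - h (f z) = k y * (y - f z)" "isCont k (f z)"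
    using h unfolding CARAT_DERIV by blast
  have "continuous (at z within U) (\<lambda>w. k (f w))"
    using continuous_within_compose3[OF k(2) cn_slope_continuous[OF assms(1,2)]] .
  moreover have "h (f w) = h (f z) + (\<Sum>i<n. k (f w) * q i w * (w i - z i))" if "w \<in> U" for w
  proof -
    have "h (f w) - h (f z) = k (f w) * (\<Sum>i<n. q i w * (w i - z i))"
      using k(1)[of "f w"] assms(1) that by (simp add: cn_slope_def)
    then show ?thesis
      by (simp add: sum_distrib_left mult.assoc algebra_simps)
  qed
  ultimately have "cn_slope n (\<lambda>w. h (f w)) z U (\<lambda>i w. k (f w) * q i w)"
    using assms(1) unfolding cn_slope_def by (simp add: continuous_mult)
  then show ?thesis
    by (rule exI[of _ "\<lambda>i w. k (f w) * q i w"])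
qed

lemma cn_holomorphic_on_cong:
  assumes "\<And>z. z \<in> U \<Longrightarrow> f z = g z"
  shows "cn_holomorphic_on n f U \<longleftrightarrow> cn_holomorphic_on n g U"
proof -
  have "((\<lambda>w. (f w - f z - (\<Sum>i<n. a i * (w i - z i))) / d w) \<longlongrightarrow> 0) (at z within U) \<longleftrightarrow>
        ((\<lambda>w. (g w - g z - (\<Sum>i<n. a i * (w i - z i))) / d w) \<longlongrightarrow> 0) (at z within U)"
    if "z \<in> U" for z a d
    using assms that by (intro tendsto_cong) (auto simp: eventually_at_filter)
  then show ?thesis
    unfolding cn_holomorphic_on_def by (intro ball_cong refl arg_cong[where f = Ex] ext) auto
qed

lemma cn_holomorphic_on_const: "cn_holomorphic_on n (\<lambda>_. c) U"
  unfolding cn_holomorphic_on_def by (intro ballI exI[of _ "\<lambda>_. 0"]) simp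

text \<open>Along the line, \<open>w i - z i\<close> becomes \<open>(s - t) * v i\<close>, so the
  difference quotient at \<open>t\<close> is exactly the sum of the slopes weighted by
  \<open>v i\<close>, which has a limit by continuity.\<close>

lemma cn_holomorphic_on_line:
  assumes f: "cn_holomorphic_on n f U" and U: "U \<subseteq> complex_space n"
    and T: "open T" and line: "\<And>t. t \<in> T \<Longrightarrow> (\<lambda>i. y i + t * v i) \<in> U"
  shows "(\<lambda>t. f (\<lambda>i. y i + t * v i)) holomorphic_on T"
proof (rule holomorphic_onI)
  fix t assume t: "t \<in> T"
  define l where "l s = (\<lambda>i. y i + s * v i)" for s
  have lU: "l s \<in> U" if "s \<in> T" for s
    using line that by (simp add: l_def)
  obtain q where q: "\<And>i. i < n \<Longrightarrow> continuous (at (l t) within U) (q i)"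
      "\<And>w. w \<in> U \<Longrightarrow> f w = f (l t) + (\<Sum>i<n. q i w * (w i - l t i))"
    using f lU[OF t] cn_holomorphic_on_iff_slope[OF U] unfolding cn_slope_def by metis
  have "continuous_on T l"
    unfolding l_def by (rule continuous_on_coordinatewise_then_product) (intro continuous_intros)
  then have l: "continuous (at t within T) l"
    using t continuous_on_eq_continuous_within by blast
  have ql: "continuous (at t within T) (\<lambda>s. q i (l s))" if "i < n" for i
    by (rule continuous_within_compose2[OF l])
       (use q(1)[OF that] lU in \<open>auto intro: continuous_within_subset\<close>)
  have "((\<lambda>s. \<Sum>i<n. q i (l s) * v i) \<longlongrightarrow> (\<Sum>i<n. q i (l t) * v i)) (at t within T)"
    by (intro tendsto_intros) (use ql in \<open>auto simp: continuous_within\<close>)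
  moreover have "(f (l s) - f (l t)) / (s - t) = (\<Sum>i<n. q i (l s) * v i)" if "s \<in> T" "s \<noteq> t" for s
  proof -
    have "f (l s) - f (l t) = (\<Sum>i<n. q i (l s) * v i) * (s - t)"
      using q(2)[OF lU[OF that(1)]]
      by (simp add: l_def sum_distrib_left sum_distrib_right ring_distribs sum_subtractf mult_ac)
    then show ?thesis
      using that by simp
  qed
  ultimately have "((\<lambda>s. (f (l s) - f (l t)) / (s - t)) \<longlongrightarrow> (\<Sum>i<n. q i (l t) * v i)) (at t within T)"
    by (subst tendsto_cong[where g = "\<lambda>s. \<Sum>i<n. q i (l s) * v i"]) (auto simp: eventually_at_filter)
  then show "(\<lambda>t. f (\<lambda>i. y i + t * v i)) field_differentiable at t within T"
    unfolding field_differentiable_def has_field_derivative_iff l_def by blast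
qed

section \<open>Discs in complex manifolds\<close>

definition polydisc :: "nat \<Rightarrow> (nat \<Rightarrow> complex) \<Rightarrow> real \<Rightarrow> (nat \<Rightarrow> complex) set" where
  "polydisc n z e = {w \<in> complex_space n. \<forall>i<n. dist (w i) (z i) < e}"

lemma openin_polydisc: "openin (top_of_set (complex_space n)) (polydisc n z e)"
proof -
  have "open (\<Inter>i<n. {w :: nat \<Rightarrow> complex. dist (w i) (z i) < e})"
    by (intro open_INT ballI open_Collect_less continuous_intros) auto
  moreover have "polydisc n z e = complex_space n \<inter> (\<Inter>i<n. {w. dist (w i) (z i) < e})"
    by (auto simp: polydisc_def)
  ultimately show ?thesis
    by (simp add: openin_open_Int)
qed

text \<open>A basic neighbourhood in the product topology contains a ball in each coordinate. All
  points of \<open>complex_space n\<close> agree from coordinate \<open>n\<close> on, so a minimum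
  of finitely many radii suffices.\<close>

lemma openin_complex_space_contains_polydisc:
  assumes "openin (top_of_set (complex_space n)) W" "z \<in> W"
  obtains e where "e > 0" "polydisc n z e \<subseteq> W"
proof -
  obtain T where T: "open T" "W = complex_space n \<inter> T"
    using assms(1) by (auto simp: openin_open)
  then have "openin (product_topology (\<lambda>_. euclidean) UNIV) T" "z \<in> T"
    using assms(2) by (auto simp: open_fun_def)
  then obtain Y where Y: "z \<in> (\<Pi>\<^sub>E i\<in>UNIV. Y i)" "\<And>i. open (Y i)" "(\<Pi>\<^sub>E i\<in>UNIV. Y i) \<subseteq> T"
    using product_topology_open_contains_basis[of "\<lambda>_. euclidean" UNIV T z] by auto
  have "\<exists>d>0. ball (z i) d \<subseteq> Y i" for i
    using Y(1,2) by (auto simp: open_contains_ball PiE_iff)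
  then obtain d where d: "\<And>i. d i > 0" "\<And>i. ball (z i) (d i) \<subseteq> Y i"
    by metis
  \<comment> \<open>The extra 1 keeps the set nonempty when \<open>n = 0\<close>.\<close>
  define e where "e = Min (insert 1 (d ` {..<n}))"
  have e: "e > 0" "\<And>i. i < n \<Longrightarrow> e \<le> d i"
    using d(1) by (auto simp: e_def Min_gr_iff intro!: Min_le)
  have "w \<in> T" if w: "w \<in> polydisc n z e" for w
  proof -
    have "w i \<in> Y i" for i
    proof (cases "i < n")
      case True
      then show ?thesis
        using w e(2)[OF True] d(2)[of i] by (force simp: polydisc_def dist_commute)
    next
      case False
      then have "w i = z i"
        using w assms(2) T(2) by (auto simp: polydisc_def complex_space_def)
      then show ?thesis
        using Y(1) by (simp add: PiE_iff)
    qed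
    then show ?thesis
      using Y(3) by (auto simp: PiE_iff)
  qed
  then show thesis
    using that[of e] e(1) T(2) by (auto simp: polydisc_def)
qed

lemma open_convex_line_in_polydisc:
  fixes n :: nat
  shows "open {t. \<forall>i<n. dist (a i + t * b i) (z i) < e}" (is ?O)
  "convex {t :: complex. \<forall>i<n. dist (a i + t * b i) (z i) < e}" (is ?C)
proof -
  have eq: "{t. \<forall>i<n. dist (a i + t * b i) (z i) < e} = (\<Inter>i<n. {t. dist (a i + t * b i) (z i) < e})"
    by auto
  show ?O
    unfolding eq by (intro open_INT ballI open_Collect_less continuous_intros finite_lessThan) 
  have "convex {t. dist (a i + t * b i) (z i) < e}" for i
  proof (rule convexI, safe)
    fix s t and u v :: real
    assume *: "dist (a i + s * b i) (z i) < e" "dist (a i + t * b i) (z i) < e" "0 \<le> u" "0 \<le> v" "u + v = 1"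
    have "u *\<^sub>R (a i + s * b i) + v *\<^sub>R (a i + t * b i) \<in> ball (z i) e"
      by (rule convexD[OF convex_ball]) (use * in \<open>auto simp: dist_commute\<close>)
    moreover have "u *\<^sub>R (a i + s * b i) + v *\<^sub>R (a i + t * b i) = (u + v) *\<^sub>R a i + (u *\<^sub>R s + v *\<^sub>R t) * b i"
      by (simp add: scaleR_add_left scaleR_add_right algebra_simps)
    ultimately show "dist (a i + (u *\<^sub>R s + v *\<^sub>R t) * b i) (z i) < e"
      using * by (simp add: dist_commute)
  qed
  then show ?C
    unfolding eq by (intro convex_INT) auto
qed

context complex_manifold
begin

text \<open>
  The disc is the piece of the complex line through \<open>y\<close> and \<open>w\<close> inside a polydisc in a chart
  around \<open>x\<close>.
\<close>

lemma local_discs: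
  assumes "x \<in> topspace X"
  obtains V where "openin X V" "x \<in> V"
    "\<And>y w. y \<in> V \<Longrightarrow> w \<in> V \<Longrightarrow>
       \<exists>S \<gamma>. open S \<and> convex S \<and> 0 \<in> S \<and> 1 \<in> S \<and> continuous_map (top_of_set S) X \<gamma> \<and>
         \<gamma> ` S \<subseteq> V \<and> \<gamma> 0 = y \<and> \<gamma> (1::complex) = w \<and>
         (\<forall>g. holomorphic_function n X A g \<longrightarrow> (\<lambda>t. g (\<gamma> t)) holomorphic_on S)"
proof -
  obtain U \<phi> where chart: "(U, \<phi>) \<in> A" and xU: "x \<in> U"
    using assms charts_cover by blast
  define \<psi> where "\<psi> = inv_into U \<phi>"
  have U: "openin X U" "U \<subseteq> topspace X"
    using chart_domain[OF chart] by (auto dest: openin_subset)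
  have hom: "homeomorphic_map (subtopology X U) (top_of_set (\<phi> ` U)) \<phi>"
    by (rule chart_homeomorphic[OF chart])
  have inj: "inj_on \<phi> U"
    using homeomorphic_imp_injective_map[OF hom] U(2) by (simp add: Int_absorb1)
  obtain \<psi>' where \<psi>': "homeomorphic_maps (subtopology X U) (top_of_set (\<phi> ` U)) \<phi> \<psi>'"
    using hom homeomorphic_map_maps by blast
  \<comment> \<open>Holomorphy is phrased with \<open>inv_into\<close>, so continuity of the inverse
    homeomorphism has to be transferred to it.\<close>
  have "\<psi>' z = \<psi> z" if "z \<in> \<phi> ` U" for z
    using that \<psi>' inj U(2) by (auto simp: homeomorphic_maps_def \<psi>_def)
  then have cont: "continuous_map (top_of_set (\<phi> ` U)) X \<psi>"
    using \<psi>' by (auto simp: homeomorphic_maps_def continuous_map_in_subtopology intro: continuous_map_eq)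
  have sub: "\<phi> ` U \<subseteq> complex_space n"
    using openin_subset[OF chart_codomain[OF chart]] by simp
  obtain e where e: "e > 0" "polydisc n (\<phi> x) e \<subseteq> \<phi> ` U"
    using openin_complex_space_contains_polydisc[OF chart_codomain[OF chart]] xU by blast
  define B where "B = polydisc n (\<phi> x) e"
  define V where "V = {p \<in> U. \<phi> p \<in> B}"
  have "openin (top_of_set (\<phi> ` U)) B"
    using openin_polydisc e(2) sub unfolding B_def by (rule openin_subset_trans)
  then have "openin (subtopology X U) V"
    using openin_continuous_map_preimage[OF homeomorphic_imp_continuous_map[OF hom], of B] U(2)
    by (simp add: V_def Int_absorb1)
  then have "openin X V"
    using U(1) openin_trans_full by blast
  moreover have "x \<in> V"
    using xU sub e(1) by (auto simp: V_def B_def polydisc_def)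
  moreover have "\<exists>S \<gamma>. open S \<and> convex S \<and> 0 \<in> S \<and> 1 \<in> S \<and> continuous_map (top_of_set S) X \<gamma> \<and>
         \<gamma> ` S \<subseteq> V \<and> \<gamma> 0 = y \<and> \<gamma> (1::complex) = w \<and>
         (\<forall>g. holomorphic_function n X A g \<longrightarrow> (\<lambda>t. g (\<gamma> t)) holomorphic_on S)"
    if y: "y \<in> V" and w: "w \<in> V" for y w
  proof -
    define l where "l t = (\<lambda>i. \<phi> y i + t * (\<phi> w i - \<phi> y i))" for t
    define S where "S = {t. \<forall>i<n. dist (\<phi> y i + t * (\<phi> w i - \<phi> y i)) (\<phi> x i) < e}"
    have S: "open S" "convex S"
      unfolding S_def by (rule open_convex_line_in_polydisc)+
    have l01: "l 0 = \<phi> y" "l 1 = \<phi> w"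
      by (auto simp: l_def)
    have lB: "l t \<in> B \<longleftrightarrow> t \<in> S" for t
      using y w by (auto simp: l_def S_def V_def B_def polydisc_def complex_space_def)
    then have lU: "l t \<in> \<phi> ` U" if "t \<in> S" for t
      using e(2) that by (auto simp: B_def)
    have "continuous_on S l"
      unfolding l_def by (rule continuous_on_coordinatewise_then_product) (intro continuous_intros)
    then have "continuous_map (top_of_set S) (top_of_set (\<phi> ` U)) l"
      using lU by (auto simp: continuous_map_in_subtopology)
    from continuous_map_compose[OF this cont] have "continuous_map (top_of_set S) X (\<lambda>t. \<psi> (l t))"
      by (simp add: o_def)
    moreover have "\<psi> (l t) \<in> V" if "t \<in> S" for t
      using lB[of t] lU[OF that] that
      by (auto simp: V_def \<psi>_def inv_into_into f_inv_into_f)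
    moreover have "(\<lambda>t. g (\<psi> (l t))) holomorphic_on S" if "holomorphic_function n X A g" for g
    proof -
      have "cn_holomorphic_on n (\<lambda>z. g (\<psi> z)) (\<phi> ` U)"
        using that chart by (auto simp: holomorphic_function_def \<psi>_def)
      then show ?thesis
        unfolding l_def by (rule cn_holomorphic_on_line[OF _ sub S(1)]) (use lU in \<open>simp add: l_def\<close>)
    qed
    moreover have "\<psi> (l 0) = y" "\<psi> (l 1) = w" "0 \<in> S" "1 \<in> S"
      using y w inj lB[of 0] lB[of 1] by (auto simp: l01 \<psi>_def V_def)
    ultimately show ?thesis
      using S by (intro exI[of _ S] exI[of _ "\<lambda>t. \<psi> (l t)"]) auto
  qed
  ultimately show thesis
    by (rule that)
qed

end

section \<open>The ring of holomorphic functions\<close>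

lemma carrier_holomorphic_ring [simp]:
    "carrier (holomorphic_ring n X A) = {f \<in> extensional (topspace X). holomorphic_function n X A f}"
  and mult_holomorphic_ring [simp]:
    "mult (holomorphic_ring n X A) = (\<lambda>f g. \<lambda>x\<in>topspace X. f x * g x)"
  and one_holomorphic_ring [simp]: "one (holomorphic_ring n X A) = (\<lambda>x\<in>topspace X. 1)"
  and zero_holomorphic_ring [simp]: "zero (holomorphic_ring n X A) = (\<lambda>x\<in>topspace X. 0)"
  and add_holomorphic_ring [simp]:
    "add (holomorphic_ring n X A) = (\<lambda>f g. \<lambda>x\<in>topspace X. f x + g x)"
  by (simp_all add: holomorphic_ring_def)

context complex_manifold
begin

lemma holomorphic_function_iff_slope:
  "holomorphic_function n X A f \<longleftrightarrow>
     (\<forall>(U, \<phi>)\<in>A. \<forall>z\<in>\<phi> ` U. \<exists>q. cn_slope n (\<lambda>z. f (inv_into U \<phi> z)) z (\<phi> ` U) q)"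
proof -
  have "\<phi> ` U \<subseteq> complex_space n" if "(U, \<phi>) \<in> A" for U \<phi>
    using openin_subset[OF chart_codomain[OF that]] by simp
  then show ?thesis
    unfolding holomorphic_function_def by (auto simp: cn_holomorphic_on_iff_slope)
qed

lemma holomorphic_function_cong:
  assumes "\<And>x. x \<in> topspace X \<Longrightarrow> f x = g x"
  shows "holomorphic_function n X A f \<longleftrightarrow> holomorphic_function n X A g"
proof -
  have "cn_holomorphic_on n (\<lambda>z. f (inv_into U \<phi> z)) (\<phi> ` U) \<longleftrightarrow>
      cn_holomorphic_on n (\<lambda>z. g (inv_into U \<phi> z)) (\<phi> ` U)" if "(U, \<phi>) \<in> A" for U \<phi>
  proof (rule cn_holomorphic_on_cong)
    fix z assume "z \<in> \<phi> ` U"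
    then have "inv_into U \<phi> z \<in> U"
      by (rule inv_into_into)
    then have "inv_into U \<phi> z \<in> topspace X"
      using openin_subset[OF chart_domain[OF that]] by blast
    then show "f (inv_into U \<phi> z) = g (inv_into U \<phi> z)"
      by (rule assms)
  qed
  then show ?thesis
    unfolding holomorphic_function_def by auto
qed

lemma holomorphic_function_restrict [simp]:
  "holomorphic_function n X A (restrict f (topspace X)) \<longleftrightarrow> holomorphic_function n X A f"
  by (rule holomorphic_function_cong) simp

lemma holomorphic_function_const [simp, intro]: "holomorphic_function n X A (\<lambda>_. c)"
  by (auto simp: holomorphic_function_def cn_holomorphic_on_const)

lemma holomorphic_function_add [intro]:
  assumes "holomorphic_function n X A f" "holomorphic_function n X A g"
  shows "holomorphic_function n X A (\<lambda>x. f x + g x)"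
  unfolding holomorphic_function_iff_slope
proof (clarify, rename_tac U \<phi> y)
  fix U \<phi> y assume "(U, \<phi>) \<in> A" and y: "y \<in> U"
  then obtain p q where "cn_slope n (\<lambda>z. f (inv_into U \<phi> z)) (\<phi> y) (\<phi> ` U) p"
      "cn_slope n (\<lambda>z. g (inv_into U \<phi> z)) (\<phi> y) (\<phi> ` U) q"
    using assms unfolding holomorphic_function_iff_slope by blast
  from cn_slope_add[OF this]
  show "\<exists>q. cn_slope n (\<lambda>z. f (inv_into U \<phi> z) + g (inv_into U \<phi> z)) (\<phi> y) (\<phi> ` U) q"
    using y by blast
qed

lemma holomorphic_function_mult [intro]:
  assumes "holomorphic_function n X A f" "holomorphic_function n X A g"
  shows "holomorphic_function n X A (\<lambda>x. f x * g x)"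
  unfolding holomorphic_function_iff_slope
proof (clarify, rename_tac U \<phi> y)
  fix U \<phi> y assume "(U, \<phi>) \<in> A" and y: "y \<in> U"
  then obtain p q where "cn_slope n (\<lambda>z. f (inv_into U \<phi> z)) (\<phi> y) (\<phi> ` U) p"
      "cn_slope n (\<lambda>z. g (inv_into U \<phi> z)) (\<phi> y) (\<phi> ` U) q"
    using assms unfolding holomorphic_function_iff_slope by blast
  from cn_slope_mult[OF this]
  show "\<exists>q. cn_slope n (\<lambda>z. f (inv_into U \<phi> z) * g (inv_into U \<phi> z)) (\<phi> y) (\<phi> ` U) q"
    using y by blast
qed

lemma holomorphic_function_compose:
  assumes "holomorphic_function n X A f" and h: "h holomorphic_on T" "open T" "f ` topspace X \<subseteq> T"
  shows "holomorphic_function n X A (\<lambda>x. h (f x))"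
  unfolding holomorphic_function_iff_slope
proof (clarify, rename_tac U \<phi> y)
  fix U \<phi> y assume chart: "(U, \<phi>) \<in> A" and y: "y \<in> U"
  then obtain q where q: "cn_slope n (\<lambda>z. f (inv_into U \<phi> z)) (\<phi> y) (\<phi> ` U) q"
    using assms(1) unfolding holomorphic_function_iff_slope by blast
  have "inv_into U \<phi> (\<phi> y) \<in> U"
    using y by (simp add: inv_into_into)
  then have "f (inv_into U \<phi> (\<phi> y)) \<in> T"
    using openin_subset[OF chart_domain[OF chart]] h(3) by blast
  then have "(h has_field_derivative deriv h (f (inv_into U \<phi> (\<phi> y)))) (at (f (inv_into U \<phi> (\<phi> y))))"
    using h holomorphic_derivI by blast
  then show "\<exists>q. cn_slope n (\<lambda>z. h (f (inv_into U \<phi> z))) (\<phi> y) (\<phi> ` U) q"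
    using cn_slope_compose[OF q] y by blast
qed

lemma cring_holomorphic_ring: "cring (holomorphic_ring n X A)"
proof (rule cringI)
  show "abelian_group (holomorphic_ring n X A)"
  proof (rule abelian_groupI)
    fix f assume "f \<in> carrier (holomorphic_ring n X A)"
    then show "\<exists>g\<in>carrier (holomorphic_ring n X A).
        g \<oplus>\<^bsub>holomorphic_ring n X A\<^esub> f = \<zero>\<^bsub>holomorphic_ring n X A\<^esub>"
      using holomorphic_function_mult[OF holomorphic_function_const[of "-1"], of f]
      by (intro bexI[of _ "\<lambda>x\<in>topspace X. - 1 * f x"]) auto
  qed (auto simp: algebra_simps fun_eq_iff extensional_def)
  show "comm_monoid (holomorphic_ring n X A)"
    by (rule comm_monoidI) (auto simp: algebra_simps fun_eq_iff extensional_def)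
qed (auto simp: algebra_simps fun_eq_iff)

lemma constant_functions_subset: "constant_functions X \<subseteq> carrier (holomorphic_ring n X A)"
  by (auto simp: constant_functions_def)

lemma carrier_ne_constant_functions_iff:
  assumes "topspace X \<noteq> {}"
  shows "carrier (holomorphic_ring n X A) \<noteq> constant_functions X \<longleftrightarrow>
    (\<exists>f\<in>carrier (holomorphic_ring n X A). \<not> f constant_on topspace X)"
proof -
  have "f \<in> constant_functions X \<longleftrightarrow> f constant_on topspace X" if "f \<in> extensional (topspace X)" for f
  proof
    assume "f constant_on topspace X"
    then obtain c where "\<And>x. x \<in> topspace X \<Longrightarrow> f x = c"
      by (auto simp: constant_on_def)
    then have "f = (\<lambda>x\<in>topspace X. c)"
      using that by (auto simp: fun_eq_iff extensional_def)
    then show "f \<in> constant_functions X"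
      by (auto simp: constant_functions_def)
  qed (auto simp: constant_functions_def constant_on_def)
  then show ?thesis
    using constant_functions_subset by auto
qed

end

section \<open>Identity theorem, open mapping and unbounded functions on connected manifolds\<close>

locale connected_complex_manifold = complex_manifold +
  assumes connected: "connected_space X"
begin

text \<open>By the identity theorem, the points near which \<open>f\<close> equals
  \<open>f x\<close> form a clopen set, since discs carry the equality across a whole neighbourhood.
  Connectedness and nonconstancy make it empty, so a neighbourhood of \<open>x\<close> from
  \<open>local_discs\<close> contains a \<open>w\<close> with another value, and the disc through
  \<open>x\<close> and \<open>w\<close> works.\<close>

lemma nonconstant_disc:
  assumes f: "holomorphic_function n X A f" "\<not> f constant_on topspace X" and x: "x \<in> topspace X"
  obtains S \<gamma> where "open S" "connected S" "(0::complex) \<in> S" "\<gamma> ` S \<subseteq> topspace X" "\<gamma> 0 = x"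
    "\<And>g. holomorphic_function n X A g \<Longrightarrow> (\<lambda>t. g (\<gamma> t)) holomorphic_on S"
    "\<not> (\<lambda>t. f (\<gamma> t)) constant_on S"
proof -
  \<comment> \<open>The interior of the level set of \<open>f\<close> through
    \<open>x\<close>.\<close>
  define L where "L = \<Union>{W. openin X W \<and> (\<forall>y\<in>W. f y = f x)}"
  have L: "openin X L"
    unfolding L_def by (rule openin_Union) auto
  have "openin X (topspace X - L)"
  proof (subst openin_subopen, safe)
    fix y assume y: "y \<in> topspace X" "y \<notin> L"
    obtain V where V: "openin X V" "y \<in> V" and disc:
      "\<And>y w. y \<in> V \<Longrightarrow> w \<in> V \<Longrightarrow>
         \<exists>S \<gamma>. open S \<and> convex S \<and> 0 \<in> S \<and> 1 \<in> S \<and> continuous_map (top_of_set S) X \<gamma> \<and>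
           \<gamma> ` S \<subseteq> V \<and> \<gamma> 0 = y \<and> \<gamma> (1::complex) = w \<and>
           (\<forall>g. holomorphic_function n X A g \<longrightarrow> (\<lambda>t. g (\<gamma> t)) holomorphic_on S)"
      using local_discs[OF y(1)] by blast
    have False if u: "u \<in> V" "u \<in> L" for u
    proof -
      obtain W where W: "openin X W" "u \<in> W" "\<And>p. p \<in> W \<Longrightarrow> f p = f x"
        using u(2) by (auto simp: L_def)
      have "f w = f x" if w: "w \<in> V" for w
      proof -
        obtain S \<gamma> where S: "open S" "convex S" "0 \<in> S" "1 \<in> S" "continuous_map (top_of_set S) X \<gamma>"
            "\<gamma> 0 = u" "\<gamma> 1 = w" and hol: "(\<lambda>t. f (\<gamma> t)) holomorphic_on S"
          using disc[OF u(1) w] f(1) by blast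
        \<comment> \<open>The preimage of \<open>W\<close> is a nonempty open subset of the
          connected set \<open>S\<close>, so the one-variable identity theorem reaches
          \<open>\<gamma> 1 = w\<close>.\<close>
        have "openin (top_of_set S) {t \<in> topspace (top_of_set S). \<gamma> t \<in> W}"
          using S(5) W(1) by (rule openin_continuous_map_preimage)
        then have "open {t \<in> S. \<gamma> t \<in> W}"
          using S(1) openin_open_eq by force
        moreover have "{t \<in> S. \<gamma> t \<in> W} \<noteq> {}"
          using S(3,6) W(2) by blast
        ultimately have "f (\<gamma> 1) = f x"
          by (rule analytic_continuation_open[where f = "\<lambda>t. f (\<gamma> t)" and g = "\<lambda>_. f x",
                OF _ S(1) _ convex_connected[OF S(2)] _ hol holomorphic_on_const _ S(4)])
             (use W(3) in blast)+
        then show ?thesis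
          by (simp add: S)
      qed
      then have "V \<subseteq> L"
        using V(1) by (auto simp: L_def)
      then show False
        using V(2) y(2) by blast
    qed
    then have "V \<subseteq> topspace X - L"
      using openin_subset[OF V(1)] by blast
    then show "\<exists>T. openin X T \<and> y \<in> T \<and> T \<subseteq> topspace X - L"
      using V by blast
  qed
  then have "closedin X L"
    using openin_subset[OF L] by (simp add: closedin_def)
  then have "L = {} \<or> L = topspace X"
    using L connected unfolding connected_space_clopen_in by blast
  moreover have "L \<noteq> topspace X"
    using f(2) by (auto simp: L_def constant_on_def)
  ultimately have "L = {}"
    by blast
  obtain V where V: "openin X V" "x \<in> V" and disc:
    "\<And>y w. y \<in> V \<Longrightarrow> w \<in> V \<Longrightarrow>
       \<exists>S \<gamma>. open S \<and> convex S \<and> 0 \<in> S \<and> 1 \<in> S \<and> continuous_map (top_of_set S) X \<gamma> \<and>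
         \<gamma> ` S \<subseteq> V \<and> \<gamma> 0 = y \<and> \<gamma> (1::complex) = w \<and>
         (\<forall>g. holomorphic_function n X A g \<longrightarrow> (\<lambda>t. g (\<gamma> t)) holomorphic_on S)"
    using local_discs[OF x] by blast
  obtain w where w: "w \<in> V" "f w \<noteq> f x"
    using V \<open>L = {}\<close> by (auto simp: L_def)
  obtain S \<gamma> where S: "open S" "convex S" "0 \<in> S" "1 \<in> S" "\<gamma> ` S \<subseteq> V" "\<gamma> 0 = x" "\<gamma> 1 = w"
      "\<And>g. holomorphic_function n X A g \<Longrightarrow> (\<lambda>t. g (\<gamma> t)) holomorphic_on S"
    using disc[OF V(2) w(1)] by metis
  have "\<not> (\<lambda>t. f (\<gamma> t)) constant_on S"
  proof
    assume "(\<lambda>t. f (\<gamma> t)) constant_on S"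
    then have "f (\<gamma> 1) = f (\<gamma> 0)"
      using S(3,4) unfolding constant_on_def by metis
    then show False
      using w(2) by (simp add: S(6,7))
  qed
  moreover have "\<gamma> ` S \<subseteq> topspace X"
    using S(5) openin_subset[OF V(1)] by blast
  ultimately show thesis
    using that[of S \<gamma>] S(1,3,6,8) convex_connected[OF S(2)] by blast
qed

text \<open>The one-variable open mapping theorem applies on a nonconstant disc through each
  point.\<close>

lemma open_holomorphic_image:
  assumes f: "holomorphic_function n X A f" "\<not> f constant_on topspace X"
  shows "open (f ` topspace X)"
proof (subst open_subopen, safe)
  fix x assume "x \<in> topspace X"
  then obtain S \<gamma> where S: "open S" "connected S" "(0::complex) \<in> S" "\<gamma> ` S \<subseteq> topspace X" "\<gamma> 0 = x"
    "(\<lambda>t. f (\<gamma> t)) holomorphic_on S" "\<not> (\<lambda>t. f (\<gamma> t)) constant_on S"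
    using nonconstant_disc[OF f] f(1) by metis
  have "open ((\<lambda>t. f (\<gamma> t)) ` S)"
    using open_mapping_thm[OF S(6,1,2,1) order_refl S(7)] .
  moreover have "f x \<in> (\<lambda>t. f (\<gamma> t)) ` S"
    using S(3,5) by force
  ultimately show "\<exists>T. open T \<and> f x \<in> T \<and> T \<subseteq> f ` topspace X"
    using S(4) by (intro exI[of _ "(\<lambda>t. f (\<gamma> t)) ` S"]) auto
qed

lemma unbounded_holomorphic_function:
  assumes f: "holomorphic_function n X A f" "\<not> f constant_on topspace X"
  obtains g where "holomorphic_function n X A g" "\<not> bounded (g ` topspace X)"
proof (cases "f ` topspace X = UNIV")
  case True
  then show thesis
    using that[OF f(1)] not_bounded_UNIV by simp
next
  case False
  have "f ` topspace X \<noteq> {}"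
    using f(2) by (auto simp: constant_on_def)
  \<comment> \<open>The plane is connected, so a nonempty proper open subset is not closed; this
    yields a point \<open>p\<close> that \<open>f\<close> approaches but omits.\<close>
  then have "\<not> closed (f ` topspace X)"
    using False open_holomorphic_image[OF f] clopen[of "f ` topspace X"] by simp
  then have "\<not> closure (f ` topspace X) \<subseteq> f ` topspace X"
    by (simp add: closure_subset_eq)
  then obtain p where p: "p \<in> closure (f ` topspace X)" "p \<notin> f ` topspace X"
    by blast
  have "holomorphic_function n X A (\<lambda>x. 1 / (f x - p))"
    by (rule holomorphic_function_compose[OF f(1), of "\<lambda>w. 1 / (w - p)" "- {p}"])
       (use p(2) in \<open>auto intro!: holomorphic_intros\<close>)
  moreover have "\<not> bounded ((\<lambda>x. 1 / (f x - p)) ` topspace X)"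
  proof
    assume "bounded ((\<lambda>x. 1 / (f x - p)) ` topspace X)"
    then obtain b where b: "b > 0" "\<And>x. x \<in> topspace X \<Longrightarrow> norm (1 / (f x - p)) \<le> b"
      by (auto simp: bounded_pos)
    obtain x where x: "x \<in> topspace X" "dist (f x) p < 1 / b"
      using p(1) b(1) unfolding closure_approachable by (force dest!: spec[of _ "1 / b"])
    have "norm (f x - p) > 0"
      using p(2) x(1) by auto
    then have "1 \<le> b * norm (f x - p)"
      using b(2)[OF x(1)] by (simp add: norm_divide divide_le_eq)
    then show False
      using x(2) b(1) by (simp add: dist_norm less_divide_eq mult.commute)
  qed
  ultimately show thesis
    by (rule that)
qed

end

section \<open>Ultrafilters, orders of growth and vanishing orders\<close>

text \<open>An ultrafilter is a minimal proper filter, found by Zorn's lemma on the proper filters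
  below \<open>F\<close> with the order reversed.\<close>

lemma exists_ultrafilter:
  assumes "F \<noteq> bot"
  obtains U where "U \<le> F" "U \<noteq> bot" "\<And>P. eventually P U \<or> eventually (\<lambda>x. \<not> P x) U"
proof -
  define A where "A = {G. G \<le> F \<and> G \<noteq> bot}"
  have "\<exists>m\<in>A. \<forall>a\<in>A. m \<ge> a \<longrightarrow> a = m"
  proof (rule predicate_Zorn)
    show "partial_order_on A (relation_of (\<ge>) A)"
      by (rule partial_order_on_relation_ofI) auto
    fix C assume C: "C \<in> Chains (relation_of (\<ge>) A)"
    show "\<exists>u\<in>A. \<forall>a\<in>C. a \<ge> u"
    proof (cases "C = {}")
      case True
      then show ?thesis
        using assms by (auto simp: A_def)
    next
      case False
      have CA: "C \<subseteq> A" and chain: "G \<le> H \<or> H \<le> G" if "G \<in> C" "H \<in> C" for G H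
        using C that by (auto simp: Chains_def relation_of_def)
      \<comment> \<open>The infimum of a nonempty chain adds no eventual properties beyond those of
        its members, so it stays proper.\<close>
      have "eventually P (Inf C) \<longleftrightarrow> (\<exists>G\<in>C. eventually P G)" for P
        using False by (rule eventually_Inf_base) (use chain in \<open>force simp: inf_absorb1 inf_absorb2\<close>)
      then have "Inf C \<noteq> bot"
        using CA by (auto simp: A_def trivial_limit_def)
      moreover have "Inf C \<le> F"
        using False CA by (auto simp: A_def intro: Inf_lower2)
      ultimately show ?thesis
        by (intro bexI[of _ "Inf C"]) (auto simp: A_def intro: Inf_lower)
    qed
  qed
  then obtain U where U: "U \<in> A" "\<And>G. G \<in> A \<Longrightarrow> G \<le> U \<Longrightarrow> G = U"
    by blast
  have "eventually P U" if "\<not> eventually (\<lambda>x. \<not> P x) U" for P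
  proof -
    \<comment> \<open>Adjoining \<open>P\<close> keeps the filter proper, so minimality forces
      \<open>P\<close> to hold eventually already.\<close>
    let ?G = "inf U (principal {x. P x})"
    have "?G \<noteq> bot"
      using that by (simp add: trivial_limit_def eventually_inf_principal)
    then have "?G \<in> A"
      using U(1) by (auto simp: A_def intro: le_infI1)
    then have "?G = U"
      using U(2) by simp
    moreover have "eventually P ?G"
      by (simp add: eventually_inf_principal)
    ultimately show ?thesis
      by (simp only:)
  qed
  then show thesis
    using that[of U] U(1) by (auto simp: A_def)
qed

text \<open>Exponentials in \<open>i\<close> of rate \<open>exp t\<close>: over all real
  \<open>t\<close> these rates are positive and strictly increasing, so different \<open>t\<close>
  differ by an exponential factor. Rounding up makes the values positive integers, usable as
  multiplicities.\<close>

definition growth :: "real \<Rightarrow> nat \<Rightarrow> nat" where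
  "growth t i = nat \<lceil>exp (exp t * real i)\<rceil>"

lemma growth_pos: "growth t i > 0"
  by (simp add: growth_def)

lemma growth_le: "real (growth t i) \<le> exp (exp t * real i) + 1"
proof -
  have "0 \<le> \<lceil>exp (exp t * real i)\<rceil>"
    using exp_gt_zero[of "exp t * real i"] by linarith
  then show ?thesis
    using of_int_ceiling_le_add_one[of "exp (exp t * real i)"] by (simp add: growth_def)
qed

lemma growth_dominates:
  assumes "s < t"
  shows "\<forall>\<^sub>F i in sequentially. k * growth s i \<le> growth t i"
proof -
  have less: "0 < exp s" "exp s < exp t"
    using assms by auto
  \<comment> \<open>The \<open>+ 1\<close> accounts for the rounding up in
    \<open>growth s i\<close>.\<close>
  have "\<forall>\<^sub>F i in sequentially. real k * (exp (a * real i) + 1) \<le> exp (b * real i)"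
    if "0 < a" "a < b" for a b :: real
    using that by real_asymp
  from this[OF less] show ?thesis
  proof eventually_elim
    case (elim i)
    have "real (k * growth s i) \<le> real k * (exp (exp s * real i) + 1)"
      unfolding of_nat_mult
      by (intro mult_left_mono growth_le) simp
    also have "\<dots> \<le> exp (exp t * real i)"
      by (rule elim)
    also have "\<dots> \<le> real (growth t i)"
      by (simp add: growth_def real_nat_ceiling_ge)
    finally show ?case
      by (simp only: of_nat_le_iff)
  qed
qed

text \<open>The quotient \<open>f / g\<close> has at most a pole at \<open>z\<close>: a finite limit
  gives the first alternative, a pole makes \<open>g / f\<close> tend to 0. Thus germs are linearly
  ordered by vanishing order.\<close>

lemma holomorphic_bigo_or_smallo:
  assumes "f holomorphic_on S" "g holomorphic_on S" "open S" "z \<in> S" "\<forall>\<^sub>F w in at z. g w \<noteq> 0"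
  shows "f \<in> O[at z](g) \<or> g \<in> o[at z](f)"
proof -
  have "not_essential (\<lambda>w. f w / g w) z"
    using assms not_essential_holomorphic[of _ S z] isolated_singularity_at_holomorphic[of _ S z]
    by (intro not_essential_divide) (auto intro: holomorphic_on_subset)
  then consider (lim) c where "((\<lambda>w. f w / g w) \<longlongrightarrow> c) (at z)" | (pole) "is_pole (\<lambda>w. f w / g w) z"
    by (auto simp: not_essential_def)
  then show ?thesis
  proof cases
    case lim
    then show ?thesis
      using assms(5) bigoI_tendsto by blast
  next
    case pole
    then have "((\<lambda>w. inverse (f w / g w)) \<longlongrightarrow> 0) (at z)"
      unfolding is_pole_def by (rule filterlim_compose[OF tendsto_inverse_0])
    moreover have "\<forall>\<^sub>F w in at z. f w \<noteq> 0"
      using non_zero_neighbour_pole[OF pole] by eventually_elim auto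
    ultimately show ?thesis
      by (intro disjI2 smalloI_tendsto) (auto simp: inverse_eq_divide)
  qed
qed

text \<open>Vanishing orders add. If both alternatives failed, comparability would give
  \<open>p\<close> in o(\<open>f\<close>) and \<open>q\<close> in o(\<open>g\<close>), and the
  hypothesis would make the product of \<open>p\<close> and \<open>q\<close> negligible against
  itself, hence zero near \<open>z\<close>.\<close>

lemma holomorphic_bigo_mult_prime:
  assumes "f holomorphic_on S" "g holomorphic_on S" "p holomorphic_on S" "q holomorphic_on S"
    and "open S" "z \<in> S" "\<forall>\<^sub>F w in at z. p w \<noteq> 0" "\<forall>\<^sub>F w in at z. q w \<noteq> 0"
    and "(\<lambda>w. f w * g w) \<in> O[at z](\<lambda>w. p w * q w)"
  shows "f \<in> O[at z](p) \<or> g \<in> O[at z](q)"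
proof (rule ccontr)
  assume "\<not> ?thesis"
  then have "p \<in> o[at z](f)" "q \<in> o[at z](g)"
    using holomorphic_bigo_or_smallo assms(1-8) by blast+
  then have "(\<lambda>w. p w * q w) \<in> o[at z](\<lambda>w. f w * g w)"
    by (rule landau_o.small.mult)
  then have "(\<lambda>w. p w * q w) \<in> o[at z](\<lambda>w. p w * q w)"
    using assms(9) by (rule landau_o.small_big_trans)
  then have "\<forall>\<^sub>F w in at z. p w * q w = 0"
    by (simp only: landau_o.small_refl_iff)
  with assms(7,8) have "\<forall>\<^sub>F w in at z. False"
    by eventually_elim simp
  then show False
    by simp
qed

lemma bigo_power_mono:
  fixes p :: "'a \<Rightarrow> complex"
  assumes "(p \<longlongrightarrow> 0) F" "a \<le> b"
  shows "(\<lambda>w. p w ^ b) \<in> O[F](\<lambda>w. p w ^ a)"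
proof -
  have "(\<lambda>w. p w ^ (b - a)) \<in> O[F](\<lambda>_. 1)"
    by (rule bigoI_tendsto[of _ _ "0 ^ (b - a)"]) (auto intro!: tendsto_eq_intros assms(1))
  then have "(\<lambda>w. p w ^ a * p w ^ (b - a)) \<in> O[F](\<lambda>w. p w ^ a * 1)"
    by (rule landau_o.big.mult_left)
  then show ?thesis
    using assms(2) by (simp flip: power_add)
qed

lemma not_bigo_power:
  fixes p :: "'a \<Rightarrow> complex"
  assumes "(p \<longlongrightarrow> 0) F" "\<forall>\<^sub>F w in F. p w \<noteq> 0" "F \<noteq> bot" "a < b"
  shows "(\<lambda>w. p w ^ a) \<notin> O[F](\<lambda>w. p w ^ b)"
proof
  have "(\<lambda>w. p w ^ (b - a)) \<in> o[F](\<lambda>_. 1)"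
    using assms(1,4) by (intro smalloI_tendsto) (auto intro!: tendsto_eq_intros)
  then have "(\<lambda>w. p w ^ a * p w ^ (b - a)) \<in> o[F](\<lambda>w. p w ^ a * 1)"
    by (rule landau_o.small.mult_left)
  then have *: "(\<lambda>w. p w ^ b) \<in> o[F](\<lambda>w. p w ^ a)"
    using assms(4) by (simp flip: power_add)
  assume "(\<lambda>w. p w ^ a) \<in> O[F](\<lambda>w. p w ^ b)"
  from landau_o.small_big_asymmetric[OF * this] assms(2) have "\<forall>\<^sub>F w in F. False"
    by eventually_elim simp
  then show False
    using assms(3) by simp
qed

text \<open>\<open>W\<close> is the Weierstrass product of a sequence listing each
  \<open>z i\<close> exactly \<open>m i\<close> times; the order of a zero is its number of
  occurrences. The elementary factors require the \<open>z i\<close> to be nonzero.\<close>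

lemma entire_function_with_zeros:
  fixes z :: "nat \<Rightarrow> complex" and m :: "nat \<Rightarrow> nat"
  assumes "inj z" "\<And>i. z i \<noteq> 0" "filterlim z at_infinity sequentially" "\<And>i. m i > 0"
  obtains W where "W holomorphic_on UNIV"
    "\<And>i. \<exists>K. isCont K (z i) \<and> K (z i) \<noteq> 0 \<and> (\<forall>\<^sub>F w in nhds (z i). W w = K w * (w - z i) ^ m i)"
proof -
  \<comment> \<open>The pair \<open>(i, j)\<close> is a copy of the zero \<open>z i\<close>;
    enumerating \<open>I\<close> flattens the repeated zeros into one sequence.\<close>
  define I where "I = Sigma UNIV (\<lambda>i. {..<m i})"
  have "(\<lambda>i. (i, 0)) ` UNIV \<subseteq> I"
    using assms(4) by (auto simp: I_def)
  then have "infinite I"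
    by (rule infinite_super) (simp add: finite_image_iff inj_on_def)
  then have b: "bij_betw (from_nat_into I) UNIV I"
    by (intro bij_betw_from_nat_into) (auto simp: I_def)
  define a where "a = z \<circ> fst \<circ> from_nat_into I"
  have vimage: "card (a -` {z i}) = m i" "finite (a -` {z i})" for i
  proof -
    have "bij_betw (from_nat_into I) (a -` {z i}) ({i} \<times> {..<m i})"
    proof (rule bij_betw_subset[OF b subset_UNIV])
      have "a -` {z i} = from_nat_into I -` ({i} \<times> UNIV)"
        using assms(1) by (auto simp: a_def inj_eq mem_Times_iff)
      then have "from_nat_into I ` (a -` {z i}) = ({i} \<times> UNIV) \<inter> I"
        using b by (auto simp: bij_betw_def)
      then show "from_nat_into I ` (a -` {z i}) = {i} \<times> {..<m i}"
        by (auto simp: I_def)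
    qed
    from bij_betw_same_card[OF this] bij_betw_finite[OF this]
    show "card (a -` {z i}) = m i" "finite (a -` {z i})"
      by (simp_all add: card_cartesian_product)
  qed
  have range_a: "range a = range z"
  proof
    show "range z \<subseteq> range a"
    proof
      fix y assume "y \<in> range z"
      then obtain i where i: "y = z i" ..
      have "a -` {z i} \<noteq> {}"
        using vimage(1)[of i] assms(4)[of i] by auto
      then obtain k where "a k = z i"
        by auto
      then show "y \<in> range a"
        using rangeI[of a k] i by simp
    qed
  qed (auto simp: a_def)
  interpret weierstrass_product' a
  proof
    show "a k \<noteq> 0" for k
      using assms(2) by (simp add: a_def)
    show "finite (a -` {y})" if "y \<in> range a" for y
      using that vimage(2) by (auto simp: range_a)
    show "filterlim a at_infinity sequentially"
      unfolding filterlim_at_infinity[OF order_refl]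
    proof safe
      \<comment> \<open>Only finitely many \<open>z i\<close> lie in a given disc, and each is
        repeated finitely often. The cofinite filter makes the order of enumeration
        immaterial.\<close>
      fix r :: real assume "r > 0"
      have "\<forall>\<^sub>F i in cofinite. r \<le> norm (z i)"
        using assms(3) \<open>r > 0\<close> by (simp add: filterlim_at_infinity[OF order_refl] cofinite_eq_sequentially)
      then have fin: "finite {i. \<not> r \<le> norm (z i)}"
        by (simp add: eventually_cofinite)
      have "{k. \<not> r \<le> norm (a k)} = (\<Union>i\<in>{i. \<not> r \<le> norm (z i)}. a -` {z i})"
        by (auto simp: a_def)
      then have "finite {k. \<not> r \<le> norm (a k)}"
        using fin vimage(2) by simp
      then show "\<forall>\<^sub>F k in sequentially. r \<le> norm (a k)"
        unfolding cofinite_eq_sequentially[symmetric] by (simp add: eventually_cofinite)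
    qed
  qed
  show thesis
  proof (rule that[of f])
    show hol: "f holomorphic_on UNIV"
      by (rule holomorphic)
    fix i
    \<comment> \<open>The product does not vanish at 0, so it is not identically zero and factors
      locally at \<open>z i\<close>.\<close>
    have nz: "\<exists>w\<in>UNIV. f w \<noteq> 0"
      using assms(2) by (intro bexI[of _ 0]) (auto simp: zero range_a)
    have "f (z i) = 0"
      by (simp add: zero range_a)
    define K where "K = zor_poly f (z i)"
    from zorder_exist_zero[OF hol open_UNIV connected_UNIV UNIV_I nz, of "z i"]
    obtain r where r: "r > 0" "K holomorphic_on cball (z i) r"
      "\<And>w. w \<in> cball (z i) r \<Longrightarrow> f w = K w * (w - z i) ^ nat (zorder f (z i)) \<and> K w \<noteq> 0"
      unfolding K_def by blast
    have "nat (zorder f (z i)) = m i"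
      by (simp add: zorder vimage(1))
    moreover have "\<forall>\<^sub>F w in nhds (z i). w \<in> ball (z i) r"
      using r(1) by (intro eventually_nhds_in_open) auto
    ultimately have "\<forall>\<^sub>F w in nhds (z i). f w = K w * (w - z i) ^ m i"
      using r(3) by (force elim: eventually_mono)
    moreover have "isCont K (z i)"
      using r(1,2) holomorphic_on_imp_continuous_on[OF r(2)]
      by (auto intro: continuous_on_interior)
    moreover have "K (z i) \<noteq> 0"
      using r(1,3) by auto
    ultimately show "\<exists>K. isCont K (z i) \<and> K (z i) \<noteq> 0 \<and> (\<forall>\<^sub>F w in nhds (z i). f w = K w * (w - z i) ^ m i)"
      by blast
  qed
qed

text \<open>Along \<open>p\<close>, \<open>K\<close> tends to the nonzero value \<open>K z\<close>,
  so only the power contributes to the order. The factorisation includes \<open>z\<close> itself, as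
  \<open>p\<close> may take that value.\<close>

lemma bigtheta_comp_zero:
  fixes p :: "'a \<Rightarrow> complex"
  assumes "isCont K z" "K z \<noteq> 0" "\<forall>\<^sub>F w in nhds z. W w = K w * (w - z) ^ m"
    and p: "(p \<longlongrightarrow> z) F"
  shows "(\<lambda>t. W (p t)) \<in> \<Theta>[F](\<lambda>t. (p t - z) ^ m)"
proof -
  have "((\<lambda>t. K (p t)) \<longlongrightarrow> K z) F"
    using assms(1) p by (rule isCont_tendsto_compose)
  then have "(\<lambda>t. K (p t)) \<in> \<Theta>[F](\<lambda>_. 1)"
    using assms(2) by (intro bigthetaI_tendsto_norm[of "norm (K z)"]) (auto intro: tendsto_norm)
  then have "(\<lambda>t. K (p t) * (p t - z) ^ m) \<in> \<Theta>[F](\<lambda>t. 1 * (p t - z) ^ m)"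
    by (rule landau_theta.mult_right)
  moreover have "\<forall>\<^sub>F t in F. W (p t) = K (p t) * (p t - z) ^ m"
    using p[unfolded filterlim_iff, rule_format, OF assms(3)] .
  ultimately show ?thesis
    by (simp add: landau_theta.in_cong)
qed

section \<open>A chain of prime ideals\<close>

text \<open>Additive inverses come from absorbing \<open>\<ominus> \<one>\<close>.\<close>

lemma (in ring) idealI_absorbing:
  assumes "I \<subseteq> carrier R" "\<zero> \<in> I"
    and "\<And>a b. a \<in> I \<Longrightarrow> b \<in> I \<Longrightarrow> a \<oplus> b \<in> I"
    and "\<And>a x. a \<in> I \<Longrightarrow> x \<in> carrier R \<Longrightarrow> x \<otimes> a \<in> I"
    and "\<And>a x. a \<in> I \<Longrightarrow> x \<in> carrier R \<Longrightarrow> a \<otimes> x \<in> I"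
  shows "ideal I R"
proof (rule idealI[OF ring_axioms])
  show "subgroup I (add_monoid R)"
  proof (rule subgroup.intro)
    fix a assume a: "a \<in> I"
    then have "\<ominus> a = (\<ominus> \<one>) \<otimes> a"
      using assms(1) l_minus[of \<one> a] by auto
    moreover have "(\<ominus> \<one>) \<otimes> a \<in> I"
      using a by (intro assms(4)) auto
    ultimately show "inv\<^bsub>add_monoid R\<^esub> a \<in> I"
      by (simp add: a_inv_def)
  qed (use assms in auto)
qed (use assms in auto)

text \<open>The data of the construction. The centre values of \<open>f\<close> are distinct,
  nonzero and tend to infinity, as the Weierstrass product demands. By
  \<open>\<U> \<le> sequentially\<close> the ultrafilter contains all cofinite sets, so eventual
  bounds in \<open>i\<close> hold almost everywhere.\<close>

locale disc_sequence = complex_manifold n X A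
  for n :: nat and X :: "'a topology" and A :: "('a set \<times> ('a \<Rightarrow> nat \<Rightarrow> complex)) set" +
  fixes f :: "'a \<Rightarrow> complex" and S :: "nat \<Rightarrow> complex set" and \<gamma> :: "nat \<Rightarrow> complex \<Rightarrow> 'a"
    and \<U> :: "nat filter"
  assumes f: "holomorphic_function n X A f"
    and open_S: "open (S i)" and zero_S: "0 \<in> S i" and disc: "\<gamma> i ` S i \<subseteq> topspace X"
    and pullback: "holomorphic_function n X A g \<Longrightarrow> (\<lambda>s. g (\<gamma> i s)) holomorphic_on S i"
    and nonconstant: "\<forall>\<^sub>F s in at 0. f (\<gamma> i s) \<noteq> f (\<gamma> i 0)"
    and inj_centres: "inj (\<lambda>i. f (\<gamma> i 0))"
    and centre_nonzero: "f (\<gamma> i 0) \<noteq> 0"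
    and centres_escape: "filterlim (\<lambda>i. f (\<gamma> i 0)) at_infinity sequentially"
    and \<U>_le: "\<U> \<le> sequentially" and \<U>_ne_bot: "\<U> \<noteq> bot"
    and ultra: "eventually Q \<U> \<or> eventually (\<lambda>i. \<not> Q i) \<U>"
begin

abbreviation R :: "('a \<Rightarrow> complex) ring" where
  "R \<equiv> holomorphic_ring n X A"

text \<open>The unit of vanishing order on each disc. It may itself vanish to order above 1;
  measured against it, \<open>W \<circ> f\<close> has the order of \<open>W\<close> at the centre
  value.\<close>

definition \<phi> :: "nat \<Rightarrow> complex \<Rightarrow> complex" where
  "\<phi> i s = f (\<gamma> i s) - f (\<gamma> i 0)"

text \<open>
  Measured in units of the order of \<open>\<phi> i\<close>, the vanishing orders of \<open>g\<close> along the discs form an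
  element of an ultrapower of the extended rationals. \<open>growth_ideal t\<close> is prime because the elements
  bounded by some multiple of \<open>growth t\<close> are closed under addition.
\<close>

definition growth_ideal :: "real \<Rightarrow> ('a \<Rightarrow> complex) set" where
  "growth_ideal t = {g \<in> carrier R.
     \<forall>k. \<forall>\<^sub>F i in \<U>. (\<lambda>s. g (\<gamma> i s)) \<in> O[at 0](\<lambda>s. \<phi> i s ^ (k * growth t i))}"

lemma holomorphic_\<phi>: "(\<lambda>s. \<phi> i s ^ m) holomorphic_on S i"
  unfolding \<phi>_def by (intro holomorphic_intros pullback f)

lemma pullback_tendsto:
  assumes "holomorphic_function n X A g"
  shows "((\<lambda>s. g (\<gamma> i s)) \<longlongrightarrow> g (\<gamma> i 0)) (at 0)"
  using holomorphic_on_imp_continuous_on[OF pullback[OF assms]] open_S zero_S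
  by (metis at_within_open continuous_on)

lemma \<phi>_tendsto: "(\<phi> i \<longlongrightarrow> 0) (at 0)"
  unfolding \<phi>_def using pullback_tendsto[OF f] by (simp add: LIM_zero)

lemma \<phi>_nonzero: "\<forall>\<^sub>F s in at 0. \<phi> i s ^ m \<noteq> 0"
  using nonconstant[of i] by eventually_elim (simp add: \<phi>_def)

text \<open>Ring operations produce restricted functions; a disc stays inside the manifold near 0,
  so restriction leaves the germ unchanged.\<close>

lemma restrict_germ:
  "(\<lambda>s. restrict g (topspace X) (\<gamma> i s)) \<in> O[at 0](h) \<longleftrightarrow> (\<lambda>s. g (\<gamma> i s)) \<in> O[at 0](h)"
proof (rule landau_o.big.in_cong)
  have "\<forall>\<^sub>F s in at 0. s \<in> S i"
    using open_S zero_S by (intro eventually_at_in_open') auto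
  then show "\<forall>\<^sub>F s in at 0. restrict g (topspace X) (\<gamma> i s) = g (\<gamma> i s)"
    by eventually_elim (use disc in auto)
qed

lemma growth_ideal_antimono:
  assumes "s < t"
  shows "growth_ideal t \<subseteq> growth_ideal s"
proof
  fix g assume g: "g \<in> growth_ideal t"
  have "\<forall>\<^sub>F i in \<U>. (\<lambda>r. g (\<gamma> i r)) \<in> O[at 0](\<lambda>r. \<phi> i r ^ (k * growth s i))" for k
  proof -
    \<comment> \<open>The instance \<open>k = 1\<close> suffices, as \<open>growth t\<close>
      eventually dominates every multiple of \<open>growth s\<close>.\<close>
    have "\<forall>\<^sub>F i in \<U>. (\<lambda>r. g (\<gamma> i r)) \<in> O[at 0](\<lambda>r. \<phi> i r ^ (1 * growth t i))"
      using g unfolding growth_ideal_def by blast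
    with filter_leD[OF \<U>_le growth_dominates[OF assms, of k]] show ?thesis
    proof eventually_elim
      case (elim i)
      then show ?case
        using landau_o.big_trans[OF _ bigo_power_mono[OF \<phi>_tendsto]] by simp
    qed
  qed
  then show "g \<in> growth_ideal s"
    using g by (simp add: growth_ideal_def)
qed

text \<open>\<open>W \<circ> f\<close>, with zeros of \<open>W\<close> of order
  \<open>growth t i\<close> at the centre values, has relative order exactly
  \<open>growth t i\<close>. For \<open>s < t\<close> this is eventually at least any multiple of
  \<open>growth s i\<close>, yet it stays below \<open>2 * growth t i\<close>.\<close>

lemma growth_ideal_witness:
  obtains g where "g \<in> carrier R" "g \<notin> growth_ideal t" "\<And>s. s < t \<Longrightarrow> g \<in> growth_ideal s"
proof -
  obtain W where W: "W holomorphic_on UNIV" and zeros: "\<And>i. \<exists>K. isCont K (f (\<gamma> i 0)) \<and>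
      K (f (\<gamma> i 0)) \<noteq> 0 \<and>
      (\<forall>\<^sub>F w in nhds (f (\<gamma> i 0)). W w = K w * (w - f (\<gamma> i 0)) ^ growth t i)"
    by (rule entire_function_with_zeros[OF inj_centres centre_nonzero centres_escape,
          where m = "growth t", OF growth_pos]) blast
  define g where "g = restrict (\<lambda>x. W (f x)) (topspace X)"
  have carrier: "g \<in> carrier R"
    using holomorphic_function_compose[OF f W] by (simp add: g_def)
  have "(\<lambda>s. W (f (\<gamma> i s))) \<in> \<Theta>[at 0](\<lambda>s. \<phi> i s ^ growth t i)" for i
    using zeros[of i] bigtheta_comp_zero[OF _ _ _ pullback_tendsto[OF f]] unfolding \<phi>_def by blast
  then have order: "(\<lambda>s. g (\<gamma> i s)) \<in> O[at 0](h) \<longleftrightarrow> (\<lambda>s. \<phi> i s ^ growth t i) \<in> O[at 0](h)" for i h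
    unfolding g_def restrict_germ by (rule landau_o.big.in_cong_bigtheta)
  have "g \<notin> growth_ideal t"
  proof
    assume "g \<in> growth_ideal t"
    then have "\<forall>\<^sub>F i in \<U>. (\<lambda>s. \<phi> i s ^ growth t i) \<in> O[at 0](\<lambda>s. \<phi> i s ^ (2 * growth t i))"
      unfolding growth_ideal_def order[symmetric] by blast
    moreover have "(\<lambda>s. \<phi> i s ^ growth t i) \<notin> O[at 0](\<lambda>s. \<phi> i s ^ (2 * growth t i))" for i
      using \<phi>_tendsto \<phi>_nonzero[of i 1] growth_pos[of t i] by (intro not_bigo_power) auto
    ultimately show False
      using \<U>_ne_bot by simp
  qed
  moreover have "g \<in> growth_ideal s" if "s < t" for s
  proof -
    have "\<forall>\<^sub>F i in \<U>. (\<lambda>r. g (\<gamma> i r)) \<in> O[at 0](\<lambda>r. \<phi> i r ^ (k * growth s i))" for k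
      using filter_leD[OF \<U>_le growth_dominates[OF that, of k]]
      by eventually_elim (simp add: order bigo_power_mono[OF \<phi>_tendsto])
    then show ?thesis
      using carrier by (simp add: growth_ideal_def)
  qed
  ultimately show thesis
    using carrier that by blast
qed

lemma growth_ideal_psubset: "s < t \<Longrightarrow> growth_ideal t \<subset> growth_ideal s"
  using growth_ideal_antimono growth_ideal_witness[of t] by (metis psubsetI)

lemma ideal_growth_ideal: "ideal (growth_ideal t) R"
proof -
  interpret cring R
    by (rule cring_holomorphic_ring)
  have mult: "g \<otimes>\<^bsub>R\<^esub> h \<in> growth_ideal t" if g: "g \<in> growth_ideal t" and h: "h \<in> carrier R" for g h
  proof -
    \<comment> \<open>A pullback has a limit at the centre, so it is bounded there and
      multiplication by it preserves every bound.\<close>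
    have "(\<lambda>s. h (\<gamma> i s)) \<in> O[at 0](\<lambda>_. 1)" for i
      using h by (intro bigoI_tendsto[of _ _ "h (\<gamma> i 0)"]) (auto intro: pullback_tendsto)
    note bounded = landau_o.big.mult[OF _ this, simplified]
    have "\<forall>\<^sub>F i in \<U>. (\<lambda>s. (g \<otimes>\<^bsub>R\<^esub> h) (\<gamma> i s)) \<in> O[at 0](\<lambda>s. \<phi> i s ^ (k * growth t i))" for k
    proof -
      have "\<forall>\<^sub>F i in \<U>. (\<lambda>s. g (\<gamma> i s)) \<in> O[at 0](\<lambda>s. \<phi> i s ^ (k * growth t i))"
        using g by (simp add: growth_ideal_def)
      then show ?thesis
        by eventually_elim (simp only: mult_holomorphic_ring restrict_germ bounded)
    qed
    moreover have "g \<otimes>\<^bsub>R\<^esub> h \<in> carrier R"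
      using g h by (intro m_closed) (auto simp: growth_ideal_def)
    ultimately show ?thesis
      unfolding growth_ideal_def by blast
  qed
  show ?thesis
  proof (rule idealI_absorbing)
    show "growth_ideal t \<subseteq> carrier R"
      by (auto simp: growth_ideal_def)
    have "\<forall>\<^sub>F i in \<U>. (\<lambda>s. \<zero>\<^bsub>R\<^esub> (\<gamma> i s)) \<in> O[at 0](\<lambda>s. \<phi> i s ^ (k * growth t i))" for k
      unfolding zero_holomorphic_ring restrict_germ by simp
    then show "\<zero>\<^bsub>R\<^esub> \<in> growth_ideal t"
      using zero_closed unfolding growth_ideal_def by blast
    fix g h assume g: "g \<in> growth_ideal t" and h: "h \<in> growth_ideal t"
    have "\<forall>\<^sub>F i in \<U>. (\<lambda>s. (g \<oplus>\<^bsub>R\<^esub> h) (\<gamma> i s)) \<in> O[at 0](\<lambda>s. \<phi> i s ^ (k * growth t i))" for k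
    proof -
      have "\<forall>\<^sub>F i in \<U>. (\<lambda>s. g (\<gamma> i s)) \<in> O[at 0](\<lambda>s. \<phi> i s ^ (k * growth t i))"
          "\<forall>\<^sub>F i in \<U>. (\<lambda>s. h (\<gamma> i s)) \<in> O[at 0](\<lambda>s. \<phi> i s ^ (k * growth t i))"
        using g h by (simp_all add: growth_ideal_def)
      then show ?thesis
        by eventually_elim (simp only: add_holomorphic_ring restrict_germ sum_in_bigo)
    qed
    moreover have "g \<oplus>\<^bsub>R\<^esub> h \<in> carrier R"
      using g h by (intro a_closed) (auto simp: growth_ideal_def)
    ultimately show "g \<oplus>\<^bsub>R\<^esub> h \<in> growth_ideal t"
      unfolding growth_ideal_def by blast
  next
    fix g h assume "g \<in> growth_ideal t" "h \<in> carrier R"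
    moreover from this have "h \<otimes>\<^bsub>R\<^esub> g = g \<otimes>\<^bsub>R\<^esub> h"
      by (intro m_comm) (auto simp: growth_ideal_def)
    ultimately show "g \<otimes>\<^bsub>R\<^esub> h \<in> growth_ideal t" "h \<otimes>\<^bsub>R\<^esub> g \<in> growth_ideal t"
      using mult by simp_all
  qed
qed

lemma primeideal_growth_ideal: "primeideal (growth_ideal t) R"
proof (rule primeidealI[OF ideal_growth_ideal cring_holomorphic_ring])
  show "carrier R \<noteq> growth_ideal t"
    using growth_ideal_witness[of t] by metis
  fix g h assume g: "g \<in> carrier R" and h: "h \<in> carrier R" and gh: "g \<otimes>\<^bsub>R\<^esub> h \<in> growth_ideal t"
  show "g \<in> growth_ideal t \<or> h \<in> growth_ideal t"
  proof (rule ccontr)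
    assume "\<not> ?thesis"
    then obtain k l where
      "\<not> (\<forall>\<^sub>F i in \<U>. (\<lambda>s. g (\<gamma> i s)) \<in> O[at 0](\<lambda>s. \<phi> i s ^ (k * growth t i)))"
      "\<not> (\<forall>\<^sub>F i in \<U>. (\<lambda>s. h (\<gamma> i s)) \<in> O[at 0](\<lambda>s. \<phi> i s ^ (l * growth t i)))"
      using g h unfolding growth_ideal_def by blast
    \<comment> \<open>For an ultrafilter, not holding almost everywhere means failing almost
      everywhere, so both bounds fail on common discs.\<close>
    then have
      "\<forall>\<^sub>F i in \<U>. (\<lambda>s. g (\<gamma> i s)) \<notin> O[at 0](\<lambda>s. \<phi> i s ^ (k * growth t i))"
      "\<forall>\<^sub>F i in \<U>. (\<lambda>s. h (\<gamma> i s)) \<notin> O[at 0](\<lambda>s. \<phi> i s ^ (l * growth t i))"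
      using ultra by blast+
    \<comment> \<open>Orders add, so the bound for the product at \<open>k + l\<close> contradicts
      failure at \<open>k\<close> and \<open>l\<close> on a single disc.\<close>
    moreover have
      "\<forall>\<^sub>F i in \<U>. (\<lambda>s. (g \<otimes>\<^bsub>R\<^esub> h) (\<gamma> i s)) \<in> O[at 0](\<lambda>s. \<phi> i s ^ ((k + l) * growth t i))"
      using gh unfolding growth_ideal_def by blast
    ultimately have "\<forall>\<^sub>F i in \<U>. False"
    proof eventually_elim
      case (elim i)
      have "(\<lambda>s. g (\<gamma> i s) * h (\<gamma> i s)) \<in> O[at 0](\<lambda>s. \<phi> i s ^ (k * growth t i) * \<phi> i s ^ (l * growth t i))"
        using elim(3) by (simp only: mult_holomorphic_ring restrict_germ distrib_right power_add)
      then have "(\<lambda>s. g (\<gamma> i s)) \<in> O[at 0](\<lambda>s. \<phi> i s ^ (k * growth t i)) \<or>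
          (\<lambda>s. h (\<gamma> i s)) \<in> O[at 0](\<lambda>s. \<phi> i s ^ (l * growth t i))"
        using g h
        by (intro holomorphic_bigo_mult_prime[OF pullback pullback holomorphic_\<phi> holomorphic_\<phi>
              open_S zero_S \<phi>_nonzero \<phi>_nonzero]) auto
      with elim(1,2) show False
        by blast
    qed
    then show False
      using \<U>_ne_bot by simp
  qed
qed

text \<open>\<open>growth_ideal\<close> is strictly decreasing, hence injective on the reals. Its
  range is infinite, so \<open>chain_length\<close> is the full cardinality.\<close>

lemma continuum_prime_chain:
  "prime_chain R (range growth_ideal)" "chain_length (range growth_ideal) =o |UNIV :: real set|"
proof -
  show "prime_chain R (range growth_ideal)"
    unfolding prime_chain_def chains_def chain_subset_def
    using primeideal_growth_ideal growth_ideal_antimono by (auto, metis linorder_cases order_refl subsetD)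
  have inj: "inj growth_ideal"
    by (rule linorder_injI) (metis growth_ideal_psubset less_irrefl)
  have "\<not> finite (range growth_ideal)"
    using inj by (simp add: finite_image_iff infinite_UNIV_char_0)
  moreover have "|UNIV :: real set| =o |range growth_ideal|"
    using inj by (intro card_of_ordIsoI) (rule inj_on_imp_bij_betw)
  ultimately show "chain_length (range growth_ideal) =o |UNIV :: real set|"
    by (simp add: chain_length_def ordIso_symmetric)
qed

end

section \<open>A chain of continuum length from a nonconstant function\<close>

context connected_complex_manifold
begin

lemma continuum_prime_chain_exists:
  assumes "holomorphic_function n X A h" "\<not> h constant_on topspace X"
  obtains C where "prime_chain (holomorphic_ring n X A) C" "chain_length C =o |UNIV :: real set|"
proof -
  obtain f where f: "holomorphic_function n X A f" "\<not> bounded (f ` topspace X)"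
    using unbounded_holomorphic_function[OF assms] by blast
  have large: "\<exists>x\<in>topspace X. b < norm (f x)" for b
    using f(2) by (force simp: bounded_iff not_le)
  \<comment> \<open>Norms start at 1 or more and increase by at least 1 per step, which makes the
    values nonzero, distinct and divergent to infinity.\<close>
  have "\<exists>x. \<forall>i. (x i \<in> topspace X \<and> 1 \<le> norm (f (x i))) \<and> norm (f (x i)) + 1 \<le> norm (f (x (Suc i)))"
  proof (rule dependent_nat_choice)
    show "\<exists>x. x \<in> topspace X \<and> 1 \<le> norm (f x)"
      using large[of 1] by (auto intro: less_imp_le)
    show "\<exists>y. (y \<in> topspace X \<and> 1 \<le> norm (f y)) \<and> norm (f x) + 1 \<le> norm (f y)"
      if "x \<in> topspace X \<and> 1 \<le> norm (f x)" for x i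
      using large[of "norm (f x) + 1"] that by force
  qed
  then obtain x where x: "\<And>i. x i \<in> topspace X" "\<And>i. 1 \<le> norm (f (x i))"
      "\<And>i. norm (f (x i)) + 1 \<le> norm (f (x (Suc i)))"
    by blast
  have "strict_mono (\<lambda>i. norm (f (x i)))"
    unfolding strict_mono_Suc_iff
  proof
    show "norm (f (x i)) < norm (f (x (Suc i)))" for i
      using x(3)[of i] by linarith
  qed
  then have inj: "inj (\<lambda>i. f (x i))"
    by (metis (mono_tags, lifting) injI strict_mono_eq)
  have "real i \<le> norm (f (x i))" for i
  proof (induction i)
    case (Suc i)
    then show ?case
      using x(3)[of i] by simp
  qed simp
  then have "filterlim (\<lambda>i. norm (f (x i))) at_top sequentially"
    by (intro filterlim_at_top_mono[OF filterlim_real_sequentially]) auto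
  then have escape: "filterlim (\<lambda>i. f (x i)) at_infinity sequentially"
    by (rule filterlim_norm_at_top_imp_at_infinity)
  have "\<not> f constant_on topspace X"
  proof
    assume "f constant_on topspace X"
    then obtain c where "f ` topspace X \<subseteq> {c}"
      by (auto simp: constant_on_def)
    then show False
      using f(2) bounded_subset[of "{c}"] by simp
  qed
  then have "\<exists>S \<gamma>. open S \<and> connected S \<and> (0::complex) \<in> S \<and> \<gamma> ` S \<subseteq> topspace X \<and> \<gamma> 0 = x i \<and>
      (\<forall>g. holomorphic_function n X A g \<longrightarrow> (\<lambda>t. g (\<gamma> t)) holomorphic_on S) \<and>
      \<not> (\<lambda>t. f (\<gamma> t)) constant_on S" for i
    by (rule nonconstant_disc[OF f(1) _ x(1)[of i]]) blast
  then obtain S \<gamma> where S: "\<And>i. open (S i)" "\<And>i. connected (S i)" "\<And>i. (0::complex) \<in> S i"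
      "\<And>i. \<gamma> i ` S i \<subseteq> topspace X" "\<And>i. \<gamma> i 0 = x i"
      "\<And>i g. holomorphic_function n X A g \<Longrightarrow> (\<lambda>t. g (\<gamma> i t)) holomorphic_on S i"
      "\<And>i. \<not> (\<lambda>t. f (\<gamma> i t)) constant_on S i"
    by metis
  obtain \<U> :: "nat filter" where \<U>: "\<U> \<le> sequentially" "\<U> \<noteq> bot"
      "\<And>P. eventually P \<U> \<or> eventually (\<lambda>i. \<not> P i) \<U>"
    using exists_ultrafilter[OF sequentially_bot] by blast
  have "\<forall>\<^sub>F t in at 0. f (\<gamma> i t) \<noteq> f (\<gamma> i 0)" for i
  proof -
    \<comment> \<open>A point with another value shows that the difference is not identically zero
      on the connected set \<open>S i\<close>, so its zeros are isolated.\<close>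
    obtain b where "b \<in> S i" "f (\<gamma> i b) \<noteq> f (\<gamma> i 0)"
      using S(7)[of i] unfolding constant_on_def by blast
    then have "\<forall>\<^sub>F t in at 0. f (\<gamma> i t) - f (\<gamma> i 0) \<noteq> 0 \<and> t \<in> S i"
      using S(1-3) S(6)[OF f(1), of i]
      by (intro non_zero_neighbour_alt[where \<beta> = b]) (auto intro!: holomorphic_intros)
    then show ?thesis
      by eventually_elim simp
  qed
  moreover have "f (x i) \<noteq> 0" for i
    using x(2)[of i] by auto
  ultimately interpret disc_sequence n X A f S \<gamma> \<U>
    using f(1) S inj escape \<U> by unfold_locales auto
  show thesis
    using continuum_prime_chain by (rule that)
qed

end

section \<open>Dimension zero when all holomorphic functions are constant\<close>

context complex_manifold
begin

text \<open>A nonzero constant is a unit, and a prime ideal contains no unit.\<close>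

lemma primeideal_eq_zero:
  assumes "carrier (holomorphic_ring n X A) = constant_functions X"
    and "primeideal I (holomorphic_ring n X A)"
  shows "I = {\<zero>\<^bsub>holomorphic_ring n X A\<^esub>}"
proof -
  let ?R = "holomorphic_ring n X A"
  interpret primeideal I ?R
    by (rule assms(2))
  have "g = \<zero>\<^bsub>?R\<^esub>" if g: "g \<in> I" for g
  proof -
    obtain c where c: "g = (\<lambda>x\<in>topspace X. c)"
      using a_Hcarr[OF g] unfolding assms(1) by (auto simp: constant_functions_def)
    have "c = 0"
    proof (rule ccontr)
      assume "c \<noteq> 0"
      then have "(\<lambda>x\<in>topspace X. inverse c) \<otimes>\<^bsub>?R\<^esub> g = \<one>\<^bsub>?R\<^esub>"
        by (auto simp: c)
      moreover have "(\<lambda>x\<in>topspace X. inverse c) \<otimes>\<^bsub>?R\<^esub> g \<in> I"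
        by (rule I_l_closed[OF g]) simp
      ultimately show False
        using one_imp_carrier I_notcarr by simp
    qed
    then show ?thesis
      by (simp add: c)
  qed
  then show ?thesis
    using additive_subgroup.zero_closed[OF is_additive_subgroup] by blast
qed

text \<open>Only the zero ideal can be prime, so a chain has one member; its least member is not
  counted, which leaves length 0. The type \<open>'b\<close> is free, since zero cardinals on
  different types are isomorphic.\<close>

lemma krull_dim_eq_czero:
  assumes "carrier (holomorphic_ring n X A) = constant_functions X"
  shows "krull_dim (holomorphic_ring n X A) =o (czero :: 'b rel)"
proof -
  let ?R = "holomorphic_ring n X A"
  have "chain_length C = czero" if "prime_chain ?R C" for C
  proof -
    have "C = {{\<zero>\<^bsub>?R\<^esub>}}"
      using that primeideal_eq_zero[OF assms] unfolding prime_chain_def chains_def by blast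
    then show ?thesis
      by (simp add: chain_length_def czero_def)
  qed
  then have "is_krull_dim ?R czero"
    by (auto simp: is_krull_dim_def czero_def card_of_Card_order card_of_empty1 ordLeq_refl)
  from krull_dim_unique[OF this] have "krull_dim ?R =o (czero :: ('a \<Rightarrow> complex) set rel)"
    by (rule ordIso_symmetric)
  also have "(czero :: ('a \<Rightarrow> complex) set rel) =o (czero :: 'b rel)"
    unfolding czero_def by (rule card_of_empty_ordIso)
  finally show ?thesis .
qed

end

section \<open>The dichotomy for the Krull dimension\<close>

theorem theorem1:
  fixes n :: nat
    and X :: "'a topology"
    and A :: "('a set \<times> ('a \<Rightarrow> nat \<Rightarrow> complex)) set"
  assumes "complex_manifold n X A"
    and "connected_space X"
    and "topspace X \<noteq> {}"
  shows "(krull_dim (holomorphic_ring n X A) =o (czero :: 'a set rel) \<or>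
          cinfinite (krull_dim (holomorphic_ring n X A))) \<and>
         (krull_dim (holomorphic_ring n X A) =o (czero :: 'a set rel) \<longleftrightarrow>
          carrier (holomorphic_ring n X A) = constant_functions X) \<and>
         (cinfinite (krull_dim (holomorphic_ring n X A)) \<longleftrightarrow>
          (\<exists>f\<in>carrier (holomorphic_ring n X A). \<not> f constant_on topspace X)) \<and>
         (carrier (holomorphic_ring n X A) \<noteq> constant_functions X \<longrightarrow>
          |UNIV :: real set| \<le>o krull_dim (holomorphic_ring n X A) \<and>
          (\<exists>C. prime_chain (holomorphic_ring n X A) C \<and>
               chain_length C =o |UNIV :: real set| ))"
proof -
  interpret connected_complex_manifold n X A
    using assms by (simp add: connected_complex_manifold_def connected_complex_manifold_axioms_def)
  let ?R = "holomorphic_ring n X A" and ?z = "czero :: 'a set rel"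
  note nonconstant_iff = carrier_ne_constant_functions_iff[OF assms(3)]
  have zero: "krull_dim ?R =o ?z" if "carrier ?R = constant_functions X"
    using that by (rule krull_dim_eq_czero)
  have chain: "\<exists>C. prime_chain ?R C \<and> chain_length C =o |UNIV :: real set|"
    if nonconst: "carrier ?R \<noteq> constant_functions X"
  proof -
    obtain h where "holomorphic_function n X A h" "\<not> h constant_on topspace X"
      using nonconst unfolding nonconstant_iff by auto
    then show ?thesis
      using continuum_prime_chain_exists by metis
  qed
  have continuum: "|UNIV :: real set| \<le>o krull_dim ?R" if nonconst: "carrier ?R \<noteq> constant_functions X"
  proof -
    obtain C where C: "prime_chain ?R C" "chain_length C =o |UNIV :: real set|"
      using chain[OF nonconst] by blast
    then have "chain_length C \<le>o krull_dim ?R"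
      using is_krull_dim_krull_dim[of ?R] by (simp add: is_krull_dim_def)
    with C(2) show ?thesis
      using ordIso_ordLeq_trans ordIso_symmetric by blast
  qed
  have infinite: "cinfinite (krull_dim ?R)" if nonconst: "carrier ?R \<noteq> constant_functions X"
    using continuum[OF nonconst]
    by (rule cinfinite_mono) (simp add: cinfinite_def Field_card_of infinite_UNIV_char_0)
  \<comment> \<open>Zero and infinite dimension exclude each other, which turns the implications
    \<open>zero\<close> and \<open>infinite\<close> into equivalences.\<close>
  have "\<not> cinfinite (krull_dim ?R)" if "krull_dim ?R =o ?z"
  proof
    assume "cinfinite (krull_dim ?R)"
    with ordIso_imp_ordLeq[OF that] have "cinfinite ?z"
      by (rule cinfinite_mono)
    then show False
      by (simp add: cinfinite_def czero_def Field_card_of)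
  qed
  then show ?thesis
    unfolding nonconstant_iff[symmetric] using zero chain continuum infinite by blast
qed

end
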